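(* In the adaptive generalized linear model described in the context, i.e. under assumptions (A1), (A2') and (A3') stated there, with the design points $X_i$ generated by the adaptive Wynn-algorithm using an arbitrary sequence of adaptive estimators $\widehat{\theta}_n$, $n\ge n_{\mathrm{st}}$, every sequence of adaptive maximum likelihood estimators $\widehat{\theta}_n^{(\mathrm{ML})}$, $n\ge n_{\mathrm{st}}$, is strongly consistent: $\widehat{\theta}_n^{(\mathrm{ML})}\to\overline{\theta}$ almost surely as $n\to\infty$.
   Context: Setting. Let $p\in\mathbb{N}$, $\mathcal{X}$ a nonempty compact metric space, $\Theta\subseteq\mathbb{R}^p$ nonempty and compact (Euclidean metric), $\overline{\theta}\in\Theta$ the fixed true parameter point. Let $f:\mathcal{X}\to\mathbb{R}^p$ be continuous with $\mathrm{span}\,f(\mathcal{X})=\mathbb{R}^p$. Let $I\subseteq\mathbb{R}$ be an open interval (possibly unbounded) with $\{f(x)^{T}\theta:(x,\theta)\in\mathcal{X}\times\Theta\}\subseteq I$ and $G:I\to\mathbb{R}$ continuously differentiable with $G'(u)>0$ for all $u\in I$. The mean response is $\mu(x,\theta)=G(f(x)^{T}\theta)$. Exponential family. Let $J\subseteq\mathbb{R}$ be an open interval and $P_\tau$, $\tau\in J$, a one-parameter exponential family in canonical parametrization: $P_\tau$ is a probability distribution on the Borel sets of $\mathbb{R}$ with density $p_\tau(y)=K(y)\exp(\tau y-b(\tau))$ with respect to some Borel measure $\nu$, where $K\ge 0$ is measurable and $b:J\to\mathbb{R}$ is infinitely often differentiable; $b'(\tau)$ and $b''(\tau)>0$ are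 the expectation and the variance of $P_\tau$. Thus $b'$ is a strictly increasing bijection from $J$ onto the open interval $\mathcal{E}=b'(J)$ of all expectations, with inverse $(b')^{-1}:\mathcal{E}\to J$. Random variables. On a probability space $(\Omega,\mathcal{F},\mathbb{P}_{\overline{\theta}})$ there are $\mathcal{X}$-valued random variables $X_i$ and real random variables $Y_i$, $i\in\mathbb{N}$. (A1) There is a nondecreasing sequence of sub-sigma-fields $\mathcal{F}_0\subseteq\mathcal{F}_1\subseteq\dots$ of $\mathcal{F}$ such that for each $i\in\mathbb{N}$, $X_i$ is $\mathcal{F}_{i-1}$-measurable and $Y_i$ is $\mathcal{F}_i$-measurable. (A2') $G(I)\subseteq\mathcal{E}$, and for each $i\in\mathbb{N}$ the conditional distribution of $Y_i$ given $\mathcal{F}_{i-1}$ is $P_{\overline{\tau}_i}$ with $\overline{\tau}_i=(b')^{-1}\bigl(G(f(X_i)^{T}\overline{\theta})\bigr)$. (A3') The functions $f_\theta$ defining information matrices are $f_\theta(x)=\varphi(f(x)^{T}\theta)\,f(x)$, $x\in\mathcal{X}$, $\theta\in\Theta$, where $\varphi(u)=G'(u)\big/\sqrt{b''\bigl((b')^{-1}(G(u))\bigr)}$, $u\in I$. Information matrices and algorithm. A design $\xi$ is a probability measure on $\mathcal{X}$ with finite support, and $M(\xi,\theta)=\sum_{x\in\mathrm{supp}(\xi)}\xi(x)f_\theta(x)f_\theta(x)^{T}$. Let $n_{\mathrm{st}}\in\mathbb{N}$, $\xi_n=\frac1n\sum_{i=1}^n\delta_{X_i}$ for $n\ge n_{\mathrm{st}}$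 (a random design; $\delta_x$ is the point mass at $x$), where $M(\xi_{n_{\mathrm{st}}},\theta)$ is positive definite for all $\theta\in\Theta$. The algorithm uses $\Theta$-valued adaptive estimators $\widehat{\theta}_n=\widehat{\theta}_n(X_1,Y_1,\dots,X_n,Y_n)$, $n\ge n_{\mathrm{st}}$, and for each $n\ge n_{\mathrm{st}}$ the point $X_{n+1}$ is (pathwise) a maximizer over $x\in\mathcal{X}$ of $f_{\widehat{\theta}_n}(x)^{T}M^{-1}(\xi_n,\widehat{\theta}_n)f_{\widehat{\theta}_n}(x)$. The estimators $\widehat{\theta}_n$ may or may not be the ML-estimators below. ML-estimators. For $n\ge n_{\mathrm{st}}$, $\widehat{\theta}_n^{(\mathrm{ML})}=\widehat{\theta}_n^{(\mathrm{ML})}(X_1,Y_1,\dots,X_n,Y_n)$ is a maximizer over $\theta\in\Theta$ of the log-likelihood $L_n(\theta)=\sum_{i=1}^n\bigl(\log K(Y_i)+\tau_i(\theta)Y_i-b(\tau_i(\theta))\bigr)$, where $\tau_i(\theta)=(b')^{-1}\bigl(G(f(X_i)^{T}\theta)\bigr)$. ($K(Y_i)>0$ for all $i$ with probability one, and this positivity is assumed in the log-likelihood.) *)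

theory Defs
  imports "HOL-Probability.Probability"
begin

definition expfam_measure ::
    "real measure \<Rightarrow> (real \<Rightarrow> real) \<Rightarrow> (real \<Rightarrow> real) \<Rightarrow> real \<Rightarrow> real measure" where
  "expfam_measure \<nu> K b \<tau> = density \<nu> (\<lambda>y. ennreal (K y * exp (\<tau> * y - b \<tau>)))"

text \<open>
  One-parameter exponential family in canonical parametrization, with parameter space \<open>J\<close>.
  That \<open>b'\<close> and \<open>b''\<close> are mean and variance follows from the other conditions; it is kept
  in the definition because it is the customary description of \<open>b\<close>. The integrability
  conditions are there because \<open>integral\<^sup>L\<close> of a non-integrable function is \<open>0\<close>.
\<close>

definition canonical_expfam ::
    "real set \<Rightarrow> real measure \<Rightarrow> (real \<Rightarrow> real) \<Rightarrow> (real \<Rightarrow> real) \<Rightarrow> bool" where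
  "canonical_expfam J \<nu> K b \<longleftrightarrow>
     open J \<and> is_interval J \<and>
     sets \<nu> = sets borel \<and>
     K \<in> borel_measurable borel \<and> (\<forall>y. 0 \<le> K y) \<and>
     (\<forall>\<tau>\<in>J. prob_space (expfam_measure \<nu> K b \<tau>)) \<and>
     (\<forall>k. \<forall>\<tau>\<in>J. (deriv ^^ k) b differentiable (at \<tau>)) \<and>
     (\<forall>\<tau>\<in>J. integrable (expfam_measure \<nu> K b \<tau>) (\<lambda>y. y) \<and>
             integrable (expfam_measure \<nu> K b \<tau>) (\<lambda>y. y\<^sup>2) \<and>
             deriv b \<tau> = prob_space.expectation (expfam_measure \<nu> K b \<tau>) (\<lambda>y. y) \<and>
             deriv (deriv b) \<tau> = prob_space.variance (expfam_measure \<nu> K b \<tau>) (\<lambda>y. y) \<and>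
             deriv (deriv b) \<tau> > 0)"

text \<open>
  \<open>\<kappa>\<close> is a (regular) conditional distribution of the real random variable \<open>Y\<close> given the
  sub-sigma-field \<open>F\<close>.
\<close>

definition is_cond_distr ::
    "'w measure \<Rightarrow> 'w measure \<Rightarrow> ('w \<Rightarrow> real) \<Rightarrow> ('w \<Rightarrow> real measure) \<Rightarrow> bool" where
  "is_cond_distr M F Y \<kappa> \<longleftrightarrow>
     \<kappa> \<in> F \<rightarrow>\<^sub>M prob_algebra borel \<and>
     (\<forall>B\<in>sets borel. AE \<omega> in M.
        real_cond_exp M F (\<lambda>\<omega>'. indicator B (Y \<omega>')) \<omega> = measure (\<kappa> \<omega>) B)"

definition canonical_param ::
    "real set \<Rightarrow> (real \<Rightarrow> real) \<Rightarrow> (real \<Rightarrow> real) \<Rightarrow> real \<Rightarrow> real" where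
  "canonical_param J b G u = inv_into J (deriv b) (G u)"

definition glm_weight ::
    "real set \<Rightarrow> (real \<Rightarrow> real) \<Rightarrow> (real \<Rightarrow> real) \<Rightarrow> real \<Rightarrow> real" where
  "glm_weight J b G u = deriv G u / sqrt (deriv (deriv b) (canonical_param J b G u))"

text \<open>The function \<open>f\<^sub>\<theta>\<close>.\<close>

definition glm_regressor ::
    "real set \<Rightarrow> (real \<Rightarrow> real) \<Rightarrow> (real \<Rightarrow> real) \<Rightarrow> ('x \<Rightarrow> real ^ 'p) \<Rightarrow> real ^ 'p \<Rightarrow> 'x \<Rightarrow> real ^ 'p" where
  "glm_regressor J b G f \<theta> x = glm_weight J b G (f x \<bullet> \<theta>) *\<^sub>R f x"

definition outer_square :: "real ^ 'p \<Rightarrow> real ^ 'p ^ 'p" where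
  "outer_square v = (\<chi> i j. v $ i * v $ j)"

text \<open>
  Designs are rendered as probability mass functions; only those with finite support occur.
  The argument \<open>g\<close> is \<open>f\<^sub>\<theta>\<close>.
\<close>

definition info_matrix :: "('x \<Rightarrow> real ^ 'p) \<Rightarrow> 'x pmf \<Rightarrow> real ^ 'p ^ 'p" where
  "info_matrix g \<xi> = (\<Sum>x\<in>set_pmf \<xi>. pmf \<xi> x *\<^sub>R outer_square (g x))"

text \<open>The uniform average of the point masses at \<open>x 1, \<dots>, x n\<close>, for \<open>n \<ge> 1\<close>.\<close>

definition empirical_design :: "(nat \<Rightarrow> 'x) \<Rightarrow> nat \<Rightarrow> 'x pmf" where
  "empirical_design x n = map_pmf x (pmf_of_set {1..n})"

lemma info_matrix_empirical_design:
  assumes "n \<ge> 1"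
  shows "info_matrix g (empirical_design x n)
    = (1 / real n) *\<^sub>R (\<Sum>i=1..n. outer_square (g (x i)))"
proof -
  have fin: "finite {1..n}" and ne: "{1..n} \<noteq> {}"
    using assms by auto
  have set: "set_pmf (empirical_design x n) = x ` {1..n}"
    using fin ne by (simp add: empirical_design_def)
  have pmf: "pmf (empirical_design x n) z = real (card {i\<in>{1..n}. x i = z}) / real n" for z
  proof -
    have "{1..n} \<inter> x -` {z} = {i\<in>{1..n}. x i = z}"
      by auto
    then show ?thesis
      using fin ne by (simp add: empirical_design_def pmf_map measure_pmf_of_set)
  qed
  have "(\<Sum>i=1..n. outer_square (g (x i)))
      = (\<Sum>z\<in>x ` {1..n}. \<Sum>i\<in>{i\<in>{1..n}. x i = z}. outer_square (g (x i)))"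
    by (rule sum.image_gen) simp
  also have "\<dots> = (\<Sum>z\<in>x ` {1..n}. real (card {i\<in>{1..n}. x i = z}) *\<^sub>R outer_square (g z))"
    by (intro sum.cong refl) (simp add: sum_constant_scaleR del: sum_constant)
  finally show ?thesis
    by (simp add: info_matrix_def set pmf scaleR_sum_right)
qed

definition pos_definite :: "real ^ 'p ^ 'p \<Rightarrow> bool" where
  "pos_definite A \<longleftrightarrow> transpose A = A \<and> (\<forall>v. v \<noteq> 0 \<longrightarrow> v \<bullet> (A *v v) > 0)"

text \<open>
  The data \<open>(X\<^sub>1, Y\<^sub>1, \<dots>, X\<^sub>n, Y\<^sub>n)\<close> as an extensional function on \<open>{1..n}\<close>: an estimator applied
  to it cannot depend on later observations.
\<close>

definition history ::
    "(nat \<Rightarrow> 'w \<Rightarrow> 'x) \<Rightarrow> (nat \<Rightarrow> 'w \<Rightarrow> real) \<Rightarrow> nat \<Rightarrow> 'w \<Rightarrow> nat \<Rightarrow> 'x \<times> real" where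
  "history X Y n \<omega> = (\<lambda>i\<in>{1..n}. (X i \<omega>, Y i \<omega>))"

definition glm_log_likelihood ::
    "real set \<Rightarrow> (real \<Rightarrow> real) \<Rightarrow> (real \<Rightarrow> real) \<Rightarrow> (real \<Rightarrow> real) \<Rightarrow> ('x \<Rightarrow> real ^ 'p) \<Rightarrow>
     nat \<Rightarrow> (nat \<Rightarrow> 'x \<times> real) \<Rightarrow> real ^ 'p \<Rightarrow> real" where
  "glm_log_likelihood J K b G f n d \<theta> =
     (\<Sum>i=1..n. let x = fst (d i); y = snd (d i); \<tau> = canonical_param J b G (f x \<bullet> \<theta>)
                in ln (K y) + \<tau> * y - b \<tau>)"

text \<open>
  Estimators are arbitrary, not necessarily measurable, functions of the data.
\<close>

definition adaptive_estimators ::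
    "'x set \<Rightarrow> (real ^ 'p) set \<Rightarrow> nat \<Rightarrow> (nat \<Rightarrow> (nat \<Rightarrow> 'x \<times> real) \<Rightarrow> real ^ 'p) \<Rightarrow> bool" where
  "adaptive_estimators S \<Theta> n0 est \<longleftrightarrow>
     (\<forall>n\<ge>n0. est n \<in> ({1..n} \<rightarrow>\<^sub>E S \<times> UNIV) \<rightarrow> \<Theta>)"

end

theory Submission
  imports Defs "HOL-Library.Discrete_Functions"
begin

text \<open>
  The theorem rests on two facts that have little to do with each other: the design carries
  information of order \<open>n\<close> in all directions, on every path, and the noise in the log-likelihood
  is of order \<open>o(n)\<close> uniformly in the parameter, almost surely.

  Information. Whatever the estimators are, the weights in \<open>f\<^sub>\<theta>\<close> stay between two positive
  constants, so that the point chosen by the algorithm maximizes \<open>f x \<bullet> A\<^sub>n\<^sup>-\<^sup>1 f x\<close> up to a constant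
  factor, where \<open>A\<^sub>n\<close> is the sum of the matrices \<open>f (X\<^sub>i) f (X\<^sub>i)\<^sup>T\<close> over \<open>i \<le> n\<close>. Let \<open>T\<^sub>n\<close> be the
  trace of the inverse of \<open>A\<^sub>n\<close>. Each step lowers \<open>T\<^sub>n\<close> by at least a constant times \<open>T\<^sub>n\<^sup>2\<close>, hence
  \<open>T\<^sub>n = O(1/n)\<close>, which means that the sum of the \<open>(f (X\<^sub>i) \<bullet> v)\<^sup>2\<close> is at least \<open>\<alpha> n \<bar>v\<bar>\<^sup>2\<close>
  (\<open>near_greedy_information_growth\<close> and \<open>wynn_information_growth\<close>).

  Noise. With \<open>\<tau>\<^sub>i(\<theta>)\<close> the canonical parameter of the \<open>i\<close>-th response, the log-likelihood ratio of
  \<open>\<theta>\<close> and the true parameter is the sum of the terms \<open>(\<tau>\<^sub>i(\<theta>) - \<tau>\<^sub>i(\<theta>bar)) (Y\<^sub>i - E Y\<^sub>i)\<close>, with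
  conditional means \<open>E Y\<^sub>i\<close> given the past, minus a sum of Kullback-Leibler divergences. The noise
  terms are orthogonal with bounded second moments, so that their averages tend to \<open>0\<close> for fixed
  \<open>\<theta>\<close> (\<open>conditionally_centered_averages_tendsto_0\<close>). They are Lipschitz in \<open>\<theta>\<close> with a constant
  governed by the averages of \<open>\<bar>Y\<^sub>i\<bar>\<close>, which are bounded for the same reason; so the convergence is
  uniform on the compact set \<open>\<Theta>\<close> (\<open>equi_Lipschitz_tendsto_0_along\<close>).

  Conclusion. The divergences are bounded below by multiples of \<open>(f (X\<^sub>i) \<bullet> (\<theta> - \<theta>bar))\<^sup>2\<close>
  (\<open>link_constants\<close>), hence their sum by a multiple of \<open>n \<bar>\<theta> - \<theta>bar\<bar>\<^sup>2\<close>. Since the likelihood at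
  its maximizer is not smaller than at \<open>\<theta>bar\<close>, the squared error of the maximizer is at most a
  constant times the averaged noise.
\<close>

section \<open>Inverses of positive definite matrices\<close>

lemma pos_definite_inner_commute:
  assumes "pos_definite A"
  shows "v \<bullet> (A *v w) = (A *v v) \<bullet> w"
  using assms by (metis pos_definite_def dot_lmul_matrix transpose_matrix_vector)

lemma pos_definite_matrix_inv:
  fixes A :: "real ^ 'n ^ 'n"
  assumes "pos_definite A"
  shows "A *v (matrix_inv A *v v) = v" "matrix_inv A *v (A *v v) = v"
proof -
  have "A *v x = 0 \<Longrightarrow> x = 0" for x
    using assms by (metis inner_zero_right less_irrefl pos_definite_def)
  then have "invertible A"
    by (simp add: invertible_left_inverse matrix_left_invertible_ker)
  then have "A ** matrix_inv A = mat 1" "matrix_inv A ** A = mat 1"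
    unfolding invertible_def matrix_inv_def by (metis (mono_tags, lifting) someI_ex)+
  then show "A *v (matrix_inv A *v v) = v" "matrix_inv A *v (A *v v) = v"
    by (simp_all add: matrix_vector_mul_assoc)
qed

lemma matrix_inv_inner_commute:
  fixes A :: "real ^ 'n ^ 'n"
  assumes "pos_definite A"
  shows "v \<bullet> (matrix_inv A *v w) = (matrix_inv A *v v) \<bullet> w"
  by (metis assms pos_definite_inner_commute pos_definite_matrix_inv(1))

lemma pos_definite_nonneg:
  assumes "pos_definite A"
  shows "0 \<le> v \<bullet> (A *v v)"
  using assms by (cases "v = 0") (auto simp: pos_definite_def less_imp_le)

lemma matrix_inv_nonneg:
  fixes A :: "real ^ 'n ^ 'n"
  assumes "pos_definite A"
  shows "0 \<le> v \<bullet> (matrix_inv A *v v)"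
  by (metis assms inner_commute pos_definite_matrix_inv(1) pos_definite_nonneg)

lemma matrix_inv_pos:
  fixes A :: "real ^ 'n ^ 'n"
  assumes "pos_definite A" "v \<noteq> 0"
  shows "0 < v \<bullet> (matrix_inv A *v v)"
  by (metis assms inner_commute matrix_vector_mult_0_right pos_definite_def pos_definite_matrix_inv(1))

text \<open>
  Cauchy-Schwarz for the inner product given by \<open>A\<close>, applied to \<open>v\<close> and \<open>A\<^sup>-\<^sup>1 w\<close>. All comparisons
  below between quadratic forms of \<open>A\<close> and of its inverse go through this inequality.
\<close>

lemma Cauchy_Schwarz_matrix_inv:
  fixes A :: "real ^ 'n ^ 'n"
  assumes A: "pos_definite A"
  shows "(v \<bullet> w)\<^sup>2 \<le> (v \<bullet> (A *v v)) * (w \<bullet> (matrix_inv A *v w))"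
proof (cases "v = 0")
  case False
  define a where "a = v \<bullet> (A *v v)"
  define c where "c = v \<bullet> w"
  define z where "z = matrix_inv A *v w"
  have a: "a > 0"
    using A False by (simp add: a_def pos_definite_def)
  have Az: "A *v z = w"
    using A by (simp add: z_def pos_definite_matrix_inv)
  have "0 \<le> (a *\<^sub>R z - c *\<^sub>R v) \<bullet> (A *v (a *\<^sub>R z - c *\<^sub>R v))"
    by (rule pos_definite_nonneg[OF A])
  also have "\<dots> = a * (a * (w \<bullet> z) - c\<^sup>2)"
    using pos_definite_inner_commute[OF A, of z v]
    by (simp add: matrix_vector_mult_diff_distrib matrix_vector_mult_scaleR Az inner_diff_left
        inner_diff_right a_def[symmetric] c_def[symmetric] inner_commute[of z w] inner_commute[of w v]
        algebra_simps power2_eq_square)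
  finally show ?thesis
    using a by (simp add: zero_le_mult_iff a_def c_def z_def)
qed auto

text \<open>
  With \<open>w = B\<^sup>-\<^sup>1 v\<close> one has \<open>v \<bullet> w = w \<bullet> B w\<close>, and Cauchy-Schwarz bounds the square of
  \<open>v \<bullet> w\<close> by \<open>(w \<bullet> A w) (v \<bullet> A\<^sup>-\<^sup>1 v) \<le> k (v \<bullet> w) (v \<bullet> A\<^sup>-\<^sup>1 v)\<close>.
\<close>

lemma matrix_inv_antimono:
  fixes A B :: "real ^ 'n ^ 'n"
  assumes A: "pos_definite A" and B: "pos_definite B" and k: "0 \<le> k"
    and le: "\<And>w. w \<bullet> (A *v w) \<le> k * (w \<bullet> (B *v w))"
  shows "v \<bullet> (matrix_inv B *v v) \<le> k * (v \<bullet> (matrix_inv A *v v))"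
proof -
  define w where "w = matrix_inv B *v v"
  define q where "q = v \<bullet> w"
  have Bw: "B *v w = v" 
    using B by (simp add: w_def pos_definite_matrix_inv)
  have q: "q \<ge> 0"
    unfolding q_def w_def by (rule matrix_inv_nonneg[OF B])
  have "q * q \<le> (w \<bullet> (A *v w)) * (v \<bullet> (matrix_inv A *v v))"
    using Cauchy_Schwarz_matrix_inv[OF A, of w v] by (simp add: q_def power2_eq_square inner_commute)
  also have "\<dots> \<le> (k * q) * (v \<bullet> (matrix_inv A *v v))"
    using le[of w] matrix_inv_nonneg[OF A, of v] by (intro mult_right_mono) (simp_all add: Bw q_def inner_commute)
  finally have "q * q \<le> q * (k * (v \<bullet> (matrix_inv A *v v)))"
    by (simp add: mult_ac)
  then have "q \<le> k * (v \<bullet> (matrix_inv A *v v))"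
    using q k matrix_inv_nonneg[OF A, of v] by (cases "q = 0") auto
  then show ?thesis by (simp add: q_def w_def)
qed

lemma outer_square_mult_vec: "outer_square v *v w = (v \<bullet> w) *\<^sub>R v"
  by (simp add: outer_square_def vec_eq_iff matrix_vector_mult_def inner_vec_def sum_distrib_left mult_ac)

lemma sum_outer_square_mult_vec:
  "(\<Sum>i\<in>I. outer_square (f i)) *v w = (\<Sum>i\<in>I. (f i \<bullet> w) *\<^sub>R f i)"
  by (induction I rule: infinite_finite_induct)
     (simp_all add: matrix_vector_mult_add_rdistrib outer_square_mult_vec)

lemma sum_outer_square_quadratic_form:
  "w \<bullet> ((\<Sum>i\<in>I. outer_square (f i)) *v w) = (\<Sum>i\<in>I. (f i \<bullet> w)\<^sup>2)"
  by (simp add: sum_outer_square_mult_vec inner_sum_right power2_eq_square inner_commute)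

lemma transpose_sum_outer_square:
  "transpose (\<Sum>i\<in>I. outer_square (f i)) = (\<Sum>i\<in>I. outer_square (f i))"
  by (simp add: outer_square_def transpose_def vec_eq_iff mult.commute)

lemma pos_definite_sum_outer_square_iff:
  "pos_definite (\<Sum>i\<in>I. outer_square (f i)) \<longleftrightarrow> (\<forall>v. v \<noteq> 0 \<longrightarrow> (\<Sum>i\<in>I. (f i \<bullet> v)\<^sup>2) > 0)"
  by (simp only: pos_definite_def transpose_sum_outer_square sum_outer_square_quadratic_form simp_thms)

text \<open>The Sherman-Morrison formula, read off from the quadratic form.\<close>

lemma matrix_inv_rank_one_update:
  fixes A :: "real ^ 'n ^ 'n" and u :: "real ^ 'n"
  assumes A: "pos_definite A" and A': "pos_definite (A + outer_square u)"
  shows "w \<bullet> (matrix_inv (A + outer_square u) *v w)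
    = w \<bullet> (matrix_inv A *v w) - (w \<bullet> (matrix_inv A *v u))\<^sup>2 / (1 + u \<bullet> (matrix_inv A *v u))"
proof -
  define p where "p = matrix_inv A *v u"
  define a where "a = matrix_inv A *v w"
  define t where "t = (u \<bullet> a) / (1 + u \<bullet> p)"
  have "1 + u \<bullet> p > 0"
    using matrix_inv_nonneg[OF A, of u] by (simp add: p_def)
  then have t: "u \<bullet> a - t * (u \<bullet> p) = t"
    by (simp add: t_def field_simps)
  have "(A + outer_square u) *v (a - t *\<^sub>R p) = w - t *\<^sub>R u + (u \<bullet> a - t * (u \<bullet> p)) *\<^sub>R u"
    using A by (simp add: matrix_vector_mult_add_rdistrib matrix_vector_mult_diff_distrib
        matrix_vector_mult_scaleR outer_square_mult_vec a_def p_def pos_definite_matrix_inv algebra_simps)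
  also have "\<dots> = w"
    by (simp add: t)
  finally have "matrix_inv (A + outer_square u) *v w = a - t *\<^sub>R p"
    using pos_definite_matrix_inv(2)[OF A'] by metis
  moreover have "u \<bullet> a = w \<bullet> p"
    using matrix_inv_inner_commute[OF A, of w u] by (simp add: a_def p_def inner_commute)
  ultimately show ?thesis
    by (simp add: inner_diff_right t_def a_def[symmetric] p_def[symmetric] power2_eq_square)
qed

text \<open>
  The trace of the inverse matrix, which is the criterion of A-optimality. It dominates the
  largest eigenvalue of the inverse, hence its reciprocal is a lower bound for the smallest
  eigenvalue of the matrix itself, and rank-one updates change it in an explicit way.
\<close>

definition inv_trace :: "real ^ 'n ^ 'n \<Rightarrow> real" where
  "inv_trace A = (\<Sum>e\<in>Basis. e \<bullet> (matrix_inv A *v e))"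

lemma inv_trace_pos:
  fixes A :: "real ^ 'n ^ 'n"
  assumes "pos_definite A"
  shows "inv_trace A > 0"
  unfolding inv_trace_def by (intro sum_pos) (auto intro!: matrix_inv_pos assms)

lemma power2_norm_eq_sum_Basis: "(norm (v :: 'a :: euclidean_space))\<^sup>2 = (\<Sum>e\<in>Basis. (e \<bullet> v)\<^sup>2)"
  unfolding power2_norm_eq_inner by (subst euclidean_inner) (simp add: power2_eq_square inner_commute)

lemma norm_le_inv_trace:
  fixes A :: "real ^ 'n ^ 'n"
  assumes A: "pos_definite A"
  shows "(norm v)\<^sup>2 \<le> inv_trace A * (v \<bullet> (A *v v))"
proof -
  have "(norm v)\<^sup>2 = (\<Sum>e\<in>Basis. (v \<bullet> e)\<^sup>2)"
    by (simp add: power2_norm_eq_sum_Basis inner_commute)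
  also have "\<dots> \<le> (\<Sum>e\<in>Basis. (v \<bullet> (A *v v)) * (e \<bullet> (matrix_inv A *v e)))"
    by (intro sum_mono Cauchy_Schwarz_matrix_inv A)
  finally show ?thesis
    by (simp add: inv_trace_def sum_distrib_left mult.commute)
qed

lemma inv_trace_rank_one_update:
  fixes A :: "real ^ 'n ^ 'n"
  assumes A: "pos_definite A" and A': "pos_definite (A + outer_square u)"
  shows "inv_trace (A + outer_square u)
    = inv_trace A - (norm (matrix_inv A *v u))\<^sup>2 / (1 + u \<bullet> (matrix_inv A *v u))"
  by (simp add: inv_trace_def matrix_inv_rank_one_update[OF A A'] sum_subtractf power2_norm_eq_sum_Basis
      sum_divide_distrib)

text \<open>
  A greedy rule controls the variances \<open>v \<bullet> A\<^sup>-\<^sup>1 v\<close> only in the directions of available points. This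
  is enough to control the trace of \<open>A\<^sup>-\<^sup>1\<close> as soon as some of the points form a nonsingular \<open>B\<close>:
  for \<open>w = A\<^sup>-\<^sup>1 e\<close> two applications of Cauchy-Schwarz give
  \<open>(e \<bullet> w)\<^sup>2 \<le> (w \<bullet> B w) (e \<bullet> B\<^sup>-\<^sup>1 e)\<close> and \<open>(w \<bullet> v\<^sub>i)\<^sup>2 \<le> (e \<bullet> w) q\<close>, where \<open>w \<bullet> B w\<close> is the sum of
  the \<open>(w \<bullet> v\<^sub>i)\<^sup>2\<close>.
\<close>

lemma inv_trace_le_max_variance:
  fixes A B :: "real ^ 'n ^ 'n" and v :: "'i \<Rightarrow> real ^ 'n"
  assumes A: "pos_definite A" and B: "pos_definite B" and Bdef: "B = (\<Sum>i\<in>N. outer_square (v i))"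
    and q: "\<And>i. i \<in> N \<Longrightarrow> v i \<bullet> (matrix_inv A *v v i) \<le> q"
  shows "inv_trace A \<le> real (card N) * q * inv_trace B"
proof -
  have "e \<bullet> (matrix_inv A *v e) \<le> real (card N) * q * (e \<bullet> (matrix_inv B *v e))" for e
  proof -
    define w where "w = matrix_inv A *v e"
    define s where "s = e \<bullet> w"
    have Aw: "A *v w = e"
      using A by (simp add: w_def pos_definite_matrix_inv)
    have s: "s \<ge> 0"
      unfolding s_def w_def by (rule matrix_inv_nonneg[OF A])
    have "w \<bullet> (B *v w) = (\<Sum>i\<in>N. (w \<bullet> v i)\<^sup>2)"
      by (simp add: Bdef sum_outer_square_quadratic_form inner_commute)
    also have "\<dots> \<le> (\<Sum>i\<in>N. s * q)"
    proof (rule sum_mono)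
      fix i assume i: "i \<in> N"
      have "(w \<bullet> v i)\<^sup>2 \<le> s * (v i \<bullet> (matrix_inv A *v v i))"
        using Cauchy_Schwarz_matrix_inv[OF A, of w "v i"] by (simp add: Aw s_def inner_commute)
      also have "\<dots> \<le> s * q"
        using q[OF i] s by (rule mult_left_mono)
      finally show "(w \<bullet> v i)\<^sup>2 \<le> s * q" .
    qed
    finally have wBw: "w \<bullet> (B *v w) \<le> real (card N) * q * s"
      by (simp add: mult_ac)
    have "s * s \<le> (w \<bullet> (B *v w)) * (e \<bullet> (matrix_inv B *v e))"
      using Cauchy_Schwarz_matrix_inv[OF B, of w e] by (simp add: s_def power2_eq_square inner_commute)
    also have "\<dots> \<le> (real (card N) * q * s) * (e \<bullet> (matrix_inv B *v e))"
      using wBw matrix_inv_nonneg[OF B] by (rule mult_right_mono)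
    finally have "s * s \<le> s * (real (card N) * q * (e \<bullet> (matrix_inv B *v e)))"
      by (simp add: mult_ac)
    moreover have "s > 0" if "e \<noteq> 0"
      using matrix_inv_pos[OF A that] by (simp add: s_def w_def)
    ultimately show ?thesis
      by (cases "e = 0") (auto simp: s_def[symmetric] w_def[symmetric])
  qed
  then show ?thesis
    by (auto simp: inv_trace_def sum_distrib_left intro!: sum_mono)
qed

section \<open>Information growth under the adaptive Wynn algorithm\<close>

lemma pos_definite_sum_outer_square_mono:
  assumes "pos_definite (\<Sum>i\<in>I. outer_square (z i))" "I \<subseteq> I'" "finite I'"
  shows "pos_definite (\<Sum>i\<in>I'. outer_square (z i))"
  unfolding pos_definite_sum_outer_square_iff
proof (intro allI impI)
  fix v :: "real ^ 'a" assume "v \<noteq> 0"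
  then have "0 < (\<Sum>i\<in>I. (z i \<bullet> v)\<^sup>2)"
    using assms(1) by (simp add: pos_definite_sum_outer_square_iff)
  also have "\<dots> \<le> (\<Sum>i\<in>I'. (z i \<bullet> v)\<^sup>2)"
    using assms(2,3) by (intro sum_mono2) auto
  finally show "0 < (\<Sum>i\<in>I'. (z i \<bullet> v)\<^sup>2)" .
qed

text \<open>
  A discrete form of the differential inequality \<open>T' \<le> - a T\<^sup>2\<close>, for which \<open>1 / T\<close> grows at
  rate at least \<open>a\<close>.
\<close>

lemma inverse_linear_growth:
  fixes T :: "nat \<Rightarrow> real"
  assumes pos: "\<And>n. n \<ge> n0 \<Longrightarrow> T n > 0" and a: "a > 0"
    and step: "\<And>n. n \<ge> n0 \<Longrightarrow> T (n + 1) \<le> T n - a * (T n)\<^sup>2"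
    and n: "n \<ge> n0"
  shows "1 / T n \<ge> 1 / T n0 + a * (real n - real n0)"
  using n
proof (induction n rule: dec_induct)
  case (step n)
  note p = pos[OF step.hyps(1)]
  have "T (n + 1) * (1 + a * T n) \<le> (T n - a * (T n)\<^sup>2) * (1 + a * T n)"
    using assms(3)[OF step.hyps(1)] p a by (intro mult_right_mono) auto
  also have "\<dots> = T n - a\<^sup>2 * (T n) ^ 3"
    by (simp add: algebra_simps power2_eq_square power3_eq_cube)
  also have "\<dots> \<le> T n"
    using p by simp
  finally have "T (n + 1) * (1 + a * T n) \<le> T n" .
  then have "(1 + a * T n) / T n \<le> 1 / T (n + 1)"
    using p pos[of "n + 1"] step.hyps(1) by (simp add: field_simps)
  then have "1 / T n + a \<le> 1 / T (n + 1)"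
    using p by (simp add: add_divide_distrib)
  then show ?case
    using step.IH by (simp add: algebra_simps)
qed simp

text \<open>
  The heart of the deterministic part. Only the comparison of \<open>z \<bullet> A\<^sub>n\<^sup>-\<^sup>1 z\<close> at each new point with its
  values at the \<open>n0\<close> starting points matters, since these already span the space. Let \<open>T\<^sub>n\<close> be the trace of the inverse of \<open>A\<^sub>n\<close> and \<open>q\<^sub>n\<close> the value of the new point. Near-greediness
  makes \<open>q\<^sub>n\<close> at least a multiple \<open>\<eta>\<close> of \<open>T\<^sub>n\<close>, and by Sherman-Morrison \<open>T\<^sub>n\<close> drops by
  \<open>\<bar>A\<^sub>n\<^sup>-\<^sup>1 z\<bar>\<^sup>2 / (1 + q\<^sub>n)\<close>, which is at least \<open>a T\<^sub>n\<^sup>2\<close> because the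
  points are bounded and \<open>q\<^sub>n \<le> \<bar>z\<bar> \<bar>A\<^sub>n\<^sup>-\<^sup>1 z\<bar>\<close>.
  A positive sequence with such drops satisfies \<open>T\<^sub>n = O(1/n)\<close>.
\<close>

lemma near_greedy_information_growth:
  fixes z :: "nat \<Rightarrow> real ^ 'n"
  defines "A \<equiv> \<lambda>n. \<Sum>i=1..n. outer_square (z i)"
  assumes n0: "n0 \<ge> 1" "pos_definite (A n0)"
    and R: "\<And>i. i \<ge> 1 \<Longrightarrow> norm (z i) \<le> R"
    and \<kappa>: "\<kappa> > 0" "\<And>n i. n \<ge> n0 \<Longrightarrow> i \<in> {1..n0} \<Longrightarrow>
        \<kappa> * (z i \<bullet> (matrix_inv (A n) *v z i)) \<le> z (n + 1) \<bullet> (matrix_inv (A n) *v z (n + 1))"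
  shows "\<exists>\<alpha>>0. \<forall>n\<ge>n0. \<forall>v. \<alpha> * real n * (norm v)\<^sup>2 \<le> (\<Sum>i=1..n. (z i \<bullet> v)\<^sup>2)"
proof -
  define T where "T n = inv_trace (A n)" for n
  have pd: "pos_definite (A n)" if "n \<ge> n0" for n
    unfolding A_def using n0 that by (intro pos_definite_sum_outer_square_mono[OF n0(2)[unfolded A_def]]) auto
  have ASuc: "A (n + 1) = A n + outer_square (z (n + 1))" for n
    by (simp add: A_def)
  have T: "T n > 0" if "n \<ge> n0" for n
    using inv_trace_pos[OF pd[OF that]] by (simp add: T_def)
  \<comment> \<open>A positive bound on the norms, to divide by.\<close>
  define R' where "R' = max R 1"
  have R': "R' > 0" "\<And>i. i \<ge> 1 \<Longrightarrow> norm (z i) \<le> R'"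
    using R by (auto simp: R'_def intro: max.coboundedI1)
  \<comment> \<open>Chosen such that \<open>\<eta> * T n \<le> q n\<close> is what \<open>inv_trace_le_max_variance\<close> yields.\<close>
  define \<eta> where "\<eta> = \<kappa> / (real n0 * T n0)"
  have \<eta>: "\<eta> > 0"
    using n0 T[of n0] \<kappa> by (simp add: \<eta>_def)
  define a where "a = \<eta>\<^sup>2 / (R'\<^sup>2 * (1 + \<eta> * T n0))"
  have pos1: "1 + \<eta> * T n0 > 0"
    using \<eta> T[of n0] by (simp add: add_pos_pos)
  have a: "a > 0"
    using \<eta> R' pos1 by (simp add: a_def)
  define p where "p n = matrix_inv (A n) *v z (n + 1)" for n
  define q where "q n = z (n + 1) \<bullet> p n" for n
  have q0: "q n \<ge> 0" if "n \<ge> n0" for n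
    using matrix_inv_nonneg[OF pd[OF that]] by (simp add: q_def p_def)
  have q: "\<eta> * T n \<le> q n" if n: "n \<ge> n0" for n
  proof -
    have "T n \<le> real (card {1..n0}) * (q n / \<kappa>) * T n0"
      unfolding T_def
    proof (rule inv_trace_le_max_variance[OF pd[OF n] n0(2), where v = z])
      show "A n0 = (\<Sum>i\<in>{1..n0}. outer_square (z i))"
        by (simp add: A_def)
    next
      fix i assume "i \<in> {1..n0}"
      from \<kappa>(2)[OF n this] show "z i \<bullet> (matrix_inv (A n) *v z i) \<le> q n / \<kappa>"
        using \<kappa>(1) by (simp add: q_def p_def field_simps)
    qed
    then show ?thesis
      using \<kappa>(1) T[of n0] n0 by (simp add: \<eta>_def field_simps)
  qed
  have Tstep: "T (n + 1) = T n - (norm (p n))\<^sup>2 / (1 + q n)" if "n \<ge> n0" for n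
    using inv_trace_rank_one_update[OF pd[OF that], of "z (n + 1)"] pd[of "n + 1"] that
    by (simp only: ASuc T_def p_def q_def)
  have Tmono: "T n \<le> T n0" if "n \<ge> n0" for n
    using that
  proof (induction n rule: dec_induct)
    case (step n)
    have "T (n + 1) \<le> T n"
      using Tstep[OF step.hyps(1)] q0[OF step.hyps(1)] by simp
    then show ?case using step.IH by simp
  qed simp
  have "T (n + 1) \<le> T n - a * (T n)\<^sup>2" if n: "n \<ge> n0" for n
  proof -
    define s where "s = \<eta> * T n"
    have s: "0 < s" "s \<le> q n" "s \<le> \<eta> * T n0"
      using \<eta> T[OF n] q[OF n] Tmono[OF n] by (simp_all add: s_def)
    have "q n \<le> R' * norm (p n)"
      using norm_cauchy_schwarz[of "z (n + 1)" "p n"] mult_right_mono[OF R'(2)[of "n + 1"], of "norm (p n)"]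
      unfolding q_def by simp
    then have "(q n)\<^sup>2 \<le> R'\<^sup>2 * (norm (p n))\<^sup>2"
      using q0[OF n] by (metis power_mono power_mult_distrib)
    then have 1: "(q n)\<^sup>2 / R'\<^sup>2 \<le> (norm (p n))\<^sup>2"
      using R' by (simp add: field_simps)
    have "a * (T n)\<^sup>2 = s\<^sup>2 / (1 + \<eta> * T n0) / R'\<^sup>2"
      by (simp add: a_def s_def power_mult_distrib)
    also have "\<dots> \<le> s\<^sup>2 / (1 + s) / R'\<^sup>2"
      using s by (intro divide_right_mono divide_left_mono mult_pos_pos) auto
    \<comment> \<open>\<open>u\<^sup>2 / (1 + u)\<close> is increasing, so the lower bound \<open>s\<close> for \<open>q n\<close> may be inserted.\<close>
    also have "s\<^sup>2 / (1 + s) \<le> (q n)\<^sup>2 / (1 + q n)"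
    proof -
      have "0 \<le> (q n - s) * (q n + s) + s * q n * (q n - s)"
        using s by simp
      then have "s\<^sup>2 * (1 + q n) \<le> (q n)\<^sup>2 * (1 + s)"
        by (simp add: algebra_simps power2_eq_square)
      then show ?thesis
        using s by (simp add: field_simps)
    qed
    then have "s\<^sup>2 / (1 + s) / R'\<^sup>2 \<le> (q n)\<^sup>2 / (1 + q n) / R'\<^sup>2"
      by (rule divide_right_mono) simp
    also have "\<dots> = (q n)\<^sup>2 / R'\<^sup>2 / (1 + q n)"
      by simp
    also have "\<dots> \<le> (norm (p n))\<^sup>2 / (1 + q n)"
      using 1 q0[OF n] by (intro divide_right_mono) auto
    finally show ?thesis
      using Tstep[OF n] by linarith
  qed
  then have inv: "1 / T n \<ge> 1 / T n0 + a * (real n - real n0)" if "n \<ge> n0" for n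
    using inverse_linear_growth[of n0 T a n] T a that by blast
  define \<alpha> where "\<alpha> = min a (1 / (real n0 * T n0))"
  have \<alpha>: "\<alpha> > 0"
    using a n0 T[of n0] by (simp add: \<alpha>_def)
  have "\<alpha> * real n * (norm v)\<^sup>2 \<le> (\<Sum>i=1..n. (z i \<bullet> v)\<^sup>2)" if n: "n \<ge> n0" for n v
  proof -
    have "\<alpha> * real n = \<alpha> * real n0 + \<alpha> * (real n - real n0)"
      by (simp add: algebra_simps)
    also have "\<dots> \<le> 1 / (real n0 * T n0) * real n0 + a * (real n - real n0)"
      using n by (intro add_mono mult_right_mono) (auto simp: \<alpha>_def)
    also have "\<dots> \<le> 1 / T n"
      using inv[OF n] n0 by simp
    finally have "\<alpha> * real n * (norm v)\<^sup>2 \<le> 1 / T n * (norm v)\<^sup>2"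
      by (rule mult_right_mono) simp
    also have "\<dots> \<le> v \<bullet> (A n *v v)"
      using norm_le_inv_trace[OF pd[OF n], of v] T[OF n] by (simp add: T_def field_simps)
    finally show ?thesis
      by (simp add: A_def sum_outer_square_quadratic_form)
  qed
  with \<alpha> show ?thesis by blast
qed

lemma pos_definite_scaleR:
  "0 < r \<Longrightarrow> pos_definite A \<Longrightarrow> pos_definite (r *\<^sub>R A)"
  by (simp add: pos_definite_def transpose_scalar scaleR_matrix_vector_assoc[symmetric])

lemma pos_definite_info_matrix_weighted_iff:
  assumes n: "n \<ge> 1" and w: "\<And>i. i \<in> {1..n} \<Longrightarrow> w (x i) \<noteq> 0"
  shows "pos_definite (info_matrix (\<lambda>s. w s *\<^sub>R f s) (empirical_design x n))
    \<longleftrightarrow> pos_definite (\<Sum>i=1..n. outer_square (f (x i)))"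
proof -
  have pos: "(\<Sum>i=1..n. (w (x i))\<^sup>2 * (f (x i) \<bullet> v)\<^sup>2) > 0 \<longleftrightarrow> (\<Sum>i=1..n. (f (x i) \<bullet> v)\<^sup>2) > 0" for v
    using w by (simp add: order_less_le sum_nonneg eq_commute[of 0] sum_nonneg_eq_0_iff)
  have "pos_definite (info_matrix (\<lambda>s. w s *\<^sub>R f s) (empirical_design x n))
    \<longleftrightarrow> pos_definite (\<Sum>i=1..n. outer_square (w (x i) *\<^sub>R f (x i)))"
    using pos_definite_scaleR[of "1 / real n" "\<Sum>i=1..n. outer_square (w (x i) *\<^sub>R f (x i))"]
      pos_definite_scaleR[of "real n" "(1 / real n) *\<^sub>R (\<Sum>i=1..n. outer_square (w (x i) *\<^sub>R f (x i)))"] n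
    by (auto simp: info_matrix_empirical_design)
  also have "\<dots> \<longleftrightarrow> pos_definite (\<Sum>i=1..n. outer_square (f (x i)))"
    using pos by (simp add: pos_definite_sum_outer_square_iff power_mult_distrib del: One_nat_def)
  finally show ?thesis .
qed

text \<open>
  The weights enter only through their bounds \<open>c1\<close> and \<open>c2\<close>: the weighted information matrix lies
  between \<open>c1\<^sup>2\<close> and \<open>c2\<^sup>2\<close> times the unweighted one, up to the common factor \<open>1 / n\<close>. Passing to
  unweighted matrices on both sides of the maximality condition costs one factor \<open>(c1 / c2)\<^sup>2\<close>, and
  replacing the weighted vectors by unweighted ones costs another.
\<close>

lemma weighted_maximizer_near_greedy:
  fixes f :: "'x \<Rightarrow> real ^ 'p" and x :: "nat \<Rightarrow> 'x" and w :: "'x \<Rightarrow> real" and s t :: 'x and n :: nat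
  defines "g \<equiv> \<lambda>s. w s *\<^sub>R f s"
  defines "A \<equiv> \<Sum>i=1..n. outer_square (f (x i))" and "B \<equiv> info_matrix g (empirical_design x n)"
  assumes n: "n \<ge> 1" and A: "pos_definite A"
    and c: "0 < c1" "\<And>i. i \<in> {1..n} \<Longrightarrow> c1 \<le> w (x i) \<and> w (x i) \<le> c2" "c1 \<le> w s" "c1 \<le> w t" "w t \<le> c2"
    and max: "g s \<bullet> (matrix_inv B *v g s) \<le> g t \<bullet> (matrix_inv B *v g t)"
  shows "(c1 / c2) ^ 4 * (f s \<bullet> (matrix_inv A *v f s)) \<le> f t \<bullet> (matrix_inv A *v f t)"
proof -
  have c2: "0 < c2" using c by linarith
  have n': "real n > 0" using n by simp
  have wx: "c1\<^sup>2 \<le> (w (x i))\<^sup>2" "(w (x i))\<^sup>2 \<le> c2\<^sup>2" if "i \<in> {1..n}" for i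
    using c(1) c(2)[OF that] by (auto intro!: power_mono)
  have B: "pos_definite B"
    unfolding B_def g_def
    by (subst pos_definite_info_matrix_weighted_iff) (use n A c(1,2) in \<open>force simp: A_def\<close>)+
  have Aq: "v \<bullet> (A *v v) = (\<Sum>i=1..n. (f (x i) \<bullet> v)\<^sup>2)" for v
    by (simp add: A_def sum_outer_square_quadratic_form)
  have Bq: "real n * (v \<bullet> (B *v v)) = (\<Sum>i=1..n. (w (x i))\<^sup>2 * (f (x i) \<bullet> v)\<^sup>2)" for v
    using n by (simp add: B_def info_matrix_empirical_design scaleR_matrix_vector_assoc[symmetric]
        sum_outer_square_quadratic_form g_def power_mult_distrib)
  have "c1\<^sup>2 * (v \<bullet> (A *v v)) \<le> real n * (v \<bullet> (B *v v))"
      "real n * (v \<bullet> (B *v v)) \<le> c2\<^sup>2 * (v \<bullet> (A *v v))" for v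
    unfolding Aq Bq sum_distrib_left using wx by (auto intro!: sum_mono mult_right_mono)
  then have AB: "v \<bullet> (A *v v) \<le> (real n / c1\<^sup>2) * (v \<bullet> (B *v v))"
    and BA: "v \<bullet> (B *v v) \<le> (c2\<^sup>2 / real n) * (v \<bullet> (A *v v))" for v
    using c n' by (simp_all add: field_simps)
  define \<alpha> where "\<alpha> v = v \<bullet> (matrix_inv A *v v)" for v
  define \<beta> where "\<beta> v = v \<bullet> (matrix_inv B *v v)" for v
  have 1: "\<beta> v \<le> (real n / c1\<^sup>2) * \<alpha> v" for v
    unfolding \<alpha>_def \<beta>_def using c n' AB by (intro matrix_inv_antimono A B) auto
  have 2: "\<alpha> v \<le> (c2\<^sup>2 / real n) * \<beta> v" for v
    unfolding \<alpha>_def \<beta>_def using c n' BA by (intro matrix_inv_antimono A B) auto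
  have \<beta>0: "\<beta> v \<ge> 0" for v
    unfolding \<beta>_def by (rule matrix_inv_nonneg[OF B])
  have gb: "g y \<bullet> (matrix_inv B *v g y) = (w y)\<^sup>2 * \<beta> (f y)" for y
    by (simp add: g_def \<beta>_def matrix_vector_mult_scaleR power2_eq_square)
  have "c1\<^sup>2 * \<beta> (f s) \<le> (w s)\<^sup>2 * \<beta> (f s)"
    using c \<beta>0 by (intro mult_right_mono power_mono) auto
  also have "\<dots> \<le> (w t)\<^sup>2 * \<beta> (f t)"
    using max by (simp add: gb)
  also have "\<dots> \<le> c2\<^sup>2 * \<beta> (f t)"
    using c \<beta>0 by (intro mult_right_mono power_mono) auto
  finally have 3: "c1\<^sup>2 * \<beta> (f s) \<le> c2\<^sup>2 * \<beta> (f t)" .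
  have "c1 ^ 4 * \<alpha> (f s) \<le> c1 ^ 4 * ((c2\<^sup>2 / real n) * \<beta> (f s))"
    using 2 by (intro mult_left_mono) auto
  also have "\<dots> = (c1\<^sup>2 * c2\<^sup>2 / real n) * (c1\<^sup>2 * \<beta> (f s))"
    by (simp add: power4_eq_xxxx power2_eq_square)
  also have "\<dots> \<le> (c1\<^sup>2 * c2\<^sup>2 / real n) * (c2\<^sup>2 * \<beta> (f t))"
    using 3 by (intro mult_left_mono) auto
  also have "\<dots> \<le> (c1\<^sup>2 * c2\<^sup>2 / real n) * (c2\<^sup>2 * ((real n / c1\<^sup>2) * \<alpha> (f t)))"
    using 1 by (intro mult_left_mono) auto
  also have "\<dots> = c2 ^ 4 * \<alpha> (f t)"
    using c n' by (simp add: power4_eq_xxxx power2_eq_square)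
  finally have "c1 ^ 4 * \<alpha> (f s) \<le> c2 ^ 4 * \<alpha> (f t)" .
  then show ?thesis
    using c2 by (simp add: \<alpha>_def power_divide field_simps)
qed

text \<open>
  The weights \<open>w n\<close> may vary arbitrarily with \<open>n\<close> within fixed bounds. This is what makes the
  result independent of the estimators that steer the algorithm.
\<close>

lemma wynn_information_growth:
  fixes f :: "'x \<Rightarrow> real ^ 'p" and x :: "nat \<Rightarrow> 'x" and w :: "nat \<Rightarrow> 'x \<Rightarrow> real"
  defines "g \<equiv> \<lambda>n s. w n s *\<^sub>R f s"
  assumes S: "\<And>i. i \<ge> 1 \<Longrightarrow> x i \<in> S" "bounded (f ` S)"
    and w: "0 < c1" "\<And>n s. n \<ge> n0 \<Longrightarrow> s \<in> S \<Longrightarrow> c1 \<le> w n s \<and> w n s \<le> c2"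
    and start: "n0 \<ge> 1" "pos_definite (info_matrix (g n0) (empirical_design x n0))"
    and max: "\<And>n s. n \<ge> n0 \<Longrightarrow> s \<in> S \<Longrightarrow>
      g n s \<bullet> (matrix_inv (info_matrix (g n) (empirical_design x n)) *v g n s)
      \<le> g n (x (n + 1)) \<bullet> (matrix_inv (info_matrix (g n) (empirical_design x n)) *v g n (x (n + 1)))"
  shows "\<exists>\<alpha>>0. \<forall>n\<ge>n0. \<forall>v. \<alpha> * real n * (norm v)\<^sup>2 \<le> (\<Sum>i=1..n. (f (x i) \<bullet> v)\<^sup>2)"
proof -
  obtain R where R: "\<And>s. s \<in> S \<Longrightarrow> norm (f s) \<le> R"
    using S(2) by (auto simp: bounded_iff)
  have pd0: "pos_definite (\<Sum>i=1..n0. outer_square (f (x i)))"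
    using start(2) unfolding g_def
    by (subst (asm) pos_definite_info_matrix_weighted_iff) (use start(1) S(1) w in force)+
  have c2: "c2 > 0"
    using w(1) w(2)[of n0 "x 1"] S(1)[of 1] by auto
  show ?thesis
  proof (rule near_greedy_information_growth[OF start(1) pd0, of R "(c1 / c2) ^ 4"])
    fix n i assume n: "n \<ge> n0" and i: "i \<in> {1..n0}"
    have "pos_definite (\<Sum>i=1..n. outer_square (f (x i)))"
      using n by (intro pos_definite_sum_outer_square_mono[OF pd0]) auto
    then show "(c1 / c2) ^ 4 * (f (x i) \<bullet> (matrix_inv (\<Sum>i=1..n. outer_square (f (x i))) *v f (x i)))
      \<le> f (x (n + 1)) \<bullet> (matrix_inv (\<Sum>i=1..n. outer_square (f (x i))) *v f (x (n + 1)))"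
      using n i start(1) S(1) w w(2)[of n] max[OF n, unfolded g_def, of "x i"]
      by (intro weighted_maximizer_near_greedy[where w = "w n"]) auto
  qed (use R S w c2 in auto)
qed

section \<open>A strong law for orthogonal random variables\<close>

context prob_space begin

lemma AE_summable_of_summable_expectation:
  fixes V :: "nat \<Rightarrow> 'a \<Rightarrow> real"
  assumes V: "\<And>k. integrable M (V k)" "\<And>k \<omega>. V k \<omega> \<ge> 0"
    and bound: "summable c" "\<And>k. expectation (V k) \<le> c k"
  shows "AE \<omega> in M. summable (\<lambda>k. V k \<omega>)"
proof -
  have [measurable]: "V k \<in> borel_measurable M" for k
    using V(1) by auto
  have c: "c k \<ge> 0" for k
    by (rule order_trans[OF Bochner_Integration.integral_nonneg bound(2)]) (rule V(2))
  have "(\<integral>\<^sup>+\<omega>. (\<Sum>k. ennreal (V k \<omega>)) \<partial>M) = (\<Sum>k. \<integral>\<^sup>+\<omega>. ennreal (V k \<omega>) \<partial>M)"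
    by (rule nn_integral_suminf) measurable
  also have "\<dots> = (\<Sum>k. ennreal (expectation (V k)))"
    using V by (intro suminf_cong nn_integral_eq_integral) auto
  also have "\<dots> \<le> (\<Sum>k. ennreal (c k))"
    using bound by (intro suminf_le ennreal_leI) auto
  also have "\<dots> = ennreal (\<Sum>k. c k)"
    using bound c by (intro suminf_ennreal2) auto
  also have "\<dots> < \<infinity>"
    by simp
  finally have "AE \<omega> in M. (\<Sum>k. ennreal (V k \<omega>)) \<noteq> \<infinity>"
    by (intro nn_integral_noteq_infinite) auto
  then show ?thesis
    by eventually_elim (use V(2) in \<open>auto intro!: summable_suminf_not_top simp: infinity_ennreal_def\<close>)
qed

lemma orthogonal_sum_second_moment:
  fixes Z :: "'i \<Rightarrow> 'a \<Rightarrow> real"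
  assumes "finite N" 
    and int: "\<And>i j. i \<in> N \<Longrightarrow> j \<in> N \<Longrightarrow> integrable M (\<lambda>\<omega>. Z i \<omega> * Z j \<omega>)"
    and orth: "\<And>i j. i \<in> N \<Longrightarrow> j \<in> N \<Longrightarrow> i \<noteq> j \<Longrightarrow> expectation (\<lambda>\<omega>. Z i \<omega> * Z j \<omega>) = 0"
  shows "integrable M (\<lambda>\<omega>. (\<Sum>i\<in>N. Z i \<omega>)\<^sup>2)"
    "expectation (\<lambda>\<omega>. (\<Sum>i\<in>N. Z i \<omega>)\<^sup>2) = (\<Sum>i\<in>N. expectation (\<lambda>\<omega>. (Z i \<omega>)\<^sup>2))"
proof -
  have eq: "(\<Sum>i\<in>N. Z i \<omega>)\<^sup>2 = (\<Sum>i\<in>N. \<Sum>j\<in>N. Z i \<omega> * Z j \<omega>)" for \<omega>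
    by (simp add: power2_eq_square sum_product)
  show "integrable M (\<lambda>\<omega>. (\<Sum>i\<in>N. Z i \<omega>)\<^sup>2)"
    unfolding eq using int by auto
  have "expectation (\<lambda>\<omega>. (\<Sum>i\<in>N. Z i \<omega>)\<^sup>2) = (\<Sum>i\<in>N. \<Sum>j\<in>N. expectation (\<lambda>\<omega>. Z i \<omega> * Z j \<omega>))"
    unfolding eq using int by (simp add: Bochner_Integration.integral_sum)
  also have "\<dots> = (\<Sum>i\<in>N. \<Sum>j\<in>N. if i = j then expectation (\<lambda>\<omega>. (Z i \<omega>)\<^sup>2) else 0)"
    using orth by (intro sum.cong refl) (auto simp: power2_eq_square)
  also have "\<dots> = (\<Sum>i\<in>N. expectation (\<lambda>\<omega>. (Z i \<omega>)\<^sup>2))"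
    using assms(1) by simp
  finally show "expectation (\<lambda>\<omega>. (\<Sum>i\<in>N. Z i \<omega>)\<^sup>2) = (\<Sum>i\<in>N. expectation (\<lambda>\<omega>. (Z i \<omega>)\<^sup>2))" .
qed

text \<open>
  The classical argument with blocks between squares. Along the squares \<open>n = k\<^sup>2\<close> the
  averages have second moments of order \<open>1 / k\<^sup>2\<close>. Between \<open>k\<^sup>2\<close> and \<open>(k + 1)\<^sup>2\<close> there are only \<open>2 k\<close>
  further terms, so that by Cauchy-Schwarz the partial sum moves in square by at most \<open>2 k\<close> times
  the sum of their squares, whose expectation divided by \<open>k\<^sup>4\<close> is again of order \<open>1 / k\<^sup>2\<close>. Hence
  \<open>V k\<close>, which bounds both contributions, is almost surely summable.
\<close>

lemma strong_law_orthogonal: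
  fixes Z :: "nat \<Rightarrow> 'a \<Rightarrow> real"
  assumes int: "\<And>i j. i \<ge> 1 \<Longrightarrow> j \<ge> 1 \<Longrightarrow> integrable M (\<lambda>\<omega>. Z i \<omega> * Z j \<omega>)"
    and orth: "\<And>i j. i \<ge> 1 \<Longrightarrow> i < j \<Longrightarrow> expectation (\<lambda>\<omega>. Z i \<omega> * Z j \<omega>) = 0"
    and C: "\<And>i. i \<ge> 1 \<Longrightarrow> expectation (\<lambda>\<omega>. (Z i \<omega>)\<^sup>2) \<le> C"
  shows "AE \<omega> in M. (\<lambda>n. (\<Sum>i=1..n. Z i \<omega>) / real n) \<longlonglongrightarrow> 0"
proof -
  define s where "s n \<omega> = (\<Sum>i=1..n. Z i \<omega>)" for n \<omega>
  define U where "U k \<omega> = (\<Sum>i\<in>{k\<^sup>2<..<(k+1)\<^sup>2}. (Z i \<omega>)\<^sup>2)" for k \<omega>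
  define V where "V k \<omega> = ((s (k\<^sup>2) \<omega>)\<^sup>2 + real (2 * k) * U k \<omega>) / real k ^ 4" for k \<omega>
  have orth': "expectation (\<lambda>\<omega>. Z i \<omega> * Z j \<omega>) = 0" if "i \<ge> 1" "j \<ge> 1" "i \<noteq> j" for i j
    using orth[of i j] orth[of j i] that by (cases "i < j") (auto simp: mult.commute)
  have int2: "integrable M (\<lambda>\<omega>. (Z i \<omega>)\<^sup>2)" if "i \<ge> 1" for i
    using int[OF that that] by (simp add: power2_eq_square)
  have s_int: "integrable M (\<lambda>\<omega>. (s n \<omega>)\<^sup>2)" for n
    unfolding s_def by (rule orthogonal_sum_second_moment(1)) (use int orth' in auto)
  have U_int: "integrable M (U k)" for k
    unfolding U_def by (intro Bochner_Integration.integrable_sum int2) auto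
  have s_exp: "expectation (\<lambda>\<omega>. (s n \<omega>)\<^sup>2) \<le> real n * C" for n
  proof -
    have "expectation (\<lambda>\<omega>. (s n \<omega>)\<^sup>2) = (\<Sum>i=1..n. expectation (\<lambda>\<omega>. (Z i \<omega>)\<^sup>2))"
      unfolding s_def by (rule orthogonal_sum_second_moment(2)) (use int orth' in auto)
    also have "\<dots> \<le> (\<Sum>i=1..n. C)"
      using C by (intro sum_mono) auto
    finally show ?thesis by simp
  qed
  have card: "real (card {k\<^sup>2<..<(k+1)\<^sup>2}) = real (2 * k)" for k :: nat
    by (simp add: power2_eq_square)
  have U_exp: "expectation (U k) \<le> real (2 * k) * C" for k
  proof -
    have "expectation (U k) = (\<Sum>i\<in>{k\<^sup>2<..<(k+1)\<^sup>2}. expectation (\<lambda>\<omega>. (Z i \<omega>)\<^sup>2))"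
      unfolding U_def by (intro Bochner_Integration.integral_sum int2) auto
    also have "\<dots> \<le> (\<Sum>i\<in>{k\<^sup>2<..<(k+1)\<^sup>2}. C)"
      using C by (intro sum_mono) auto
    finally show ?thesis by (simp only: sum_constant card)
  qed
  have V_int: "integrable M (V k)" for k
    unfolding V_def using s_int U_int by auto
  have V_exp: "expectation (V k) \<le> 5 * C * (1 / real k ^ 2)" for k
  proof (cases "k = 0")
    case False
    have "expectation (V k) = (expectation (\<lambda>\<omega>. (s (k\<^sup>2) \<omega>)\<^sup>2) + real (2 * k) * expectation (U k)) / real k ^ 4"
      unfolding V_def using s_int U_int by simp
    also have "\<dots> \<le> (real (k\<^sup>2) * C + real (2 * k) * (real (2 * k) * C)) / real k ^ 4"
      by (intro divide_right_mono add_mono mult_left_mono s_exp U_exp) auto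
    also have "\<dots> = 5 * C * (1 / real k ^ 2)"
      using False by (simp add: field_simps power2_eq_square power4_eq_xxxx)
    finally show ?thesis .
  qed (simp add: V_def[abs_def])
  have V0: "V k \<omega> \<ge> 0" for k \<omega>
    by (simp add: V_def U_def sum_nonneg)
  have "summable (\<lambda>k. 5 * C * (1 / real k ^ 2))"
    using inverse_power_summable[of 2, where 'a = real] by (intro summable_mult) (simp add: inverse_eq_divide)
  from AE_summable_of_summable_expectation[OF V_int V0 this V_exp]
  show ?thesis
  proof eventually_elim
    case (elim \<omega>)
    then have "(\<lambda>k. V k \<omega>) \<longlonglongrightarrow> 0"
      by (rule summable_LIMSEQ_zero)
    moreover have "filterlim floor_sqrt at_top sequentially"
    proof (rule filterlim_at_top_mono[where g = floor_sqrt])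
      show "filterlim floor_sqrt at_top sequentially"
        unfolding filterlim_at_top eventually_sequentially
        by (metis floor_sqrt_inverse_power2 mono_floor_sqrt')
    qed simp
    ultimately have "(\<lambda>n. V (floor_sqrt n) \<omega>) \<longlonglongrightarrow> 0"
      by (rule filterlim_compose)
    then have lim: "(\<lambda>n. sqrt (2 * V (floor_sqrt n) \<omega>)) \<longlonglongrightarrow> 0"
      by (auto intro!: tendsto_eq_intros)
    have "\<bar>s n \<omega> / real n\<bar> \<le> sqrt (2 * V (floor_sqrt n) \<omega>)" if n: "n \<ge> 1" for n
    proof -
      define k where "k = floor_sqrt n"
      have k: "k\<^sup>2 \<le> n" "n < (k + 1)\<^sup>2" "k > 0"
        using n Suc_floor_sqrt_power2_gt[of n] by (simp_all add: k_def)
      have "s n \<omega> = s (k\<^sup>2) \<omega> + (\<Sum>i\<in>{k\<^sup>2<..n}. Z i \<omega>)"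
      proof -
        have "{1..n} = {1..k\<^sup>2} \<union> {k\<^sup>2<..n}" "{1..k\<^sup>2} \<inter> {k\<^sup>2<..n} = {}"
          using k by auto
        then show ?thesis by (simp add: s_def sum.union_disjoint)
      qed
      also have "\<dots>\<^sup>2 \<le> 2 * (s (k\<^sup>2) \<omega>)\<^sup>2 + 2 * (\<Sum>i\<in>{k\<^sup>2<..n}. Z i \<omega>)\<^sup>2"
        using sum_squares_bound[of "s (k\<^sup>2) \<omega>" "\<Sum>i\<in>{k\<^sup>2<..n}. Z i \<omega>"] by (simp add: power2_sum)
      also have "(\<Sum>i\<in>{k\<^sup>2<..n}. Z i \<omega>)\<^sup>2 \<le> (\<Sum>i\<in>{k\<^sup>2<..n}. (Z i \<omega>)\<^sup>2) * real (card {k\<^sup>2<..n})"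
        by (rule sum_squared_le_sum_of_squares)
      also have "\<dots> \<le> U k \<omega> * real (2 * k)"
      proof (rule mult_mono)
        show "(\<Sum>i\<in>{k\<^sup>2<..n}. (Z i \<omega>)\<^sup>2) \<le> U k \<omega>"
          unfolding U_def using k by (intro sum_mono2) auto
        have "card {k\<^sup>2<..n} \<le> 2 * k"
          using k by (simp add: power2_eq_square)
        then show "real (card {k\<^sup>2<..n}) \<le> real (2 * k)"
          by (rule of_nat_mono)
        show "0 \<le> U k \<omega>" by (simp add: U_def sum_nonneg)
      qed simp
      finally have "(s n \<omega>)\<^sup>2 \<le> 2 * (s (k\<^sup>2) \<omega>)\<^sup>2 + 2 * (U k \<omega> * real (2 * k))"
        by simp
      also have "\<dots> = 2 * V k \<omega> * real k ^ 4"
        using k(3) by (simp add: V_def field_simps)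
      also have "\<dots> \<le> 2 * V k \<omega> * (real n)\<^sup>2"
      proof (rule mult_left_mono)
        have "real (k\<^sup>2) \<le> real n" using k(1) by (rule of_nat_mono)
        then have "(real (k\<^sup>2))\<^sup>2 \<le> (real n)\<^sup>2" by (rule power_mono) simp
        then show "real k ^ 4 \<le> (real n)\<^sup>2" by simp
      qed (simp add: V0)
      finally have "(s n \<omega> / real n)\<^sup>2 \<le> 2 * V k \<omega>"
        using n by (simp add: power_divide field_simps)
      from real_sqrt_le_mono[OF this] show ?thesis
        by (simp only: k_def real_sqrt_abs)
    qed
    then have "eventually (\<lambda>n. norm (s n \<omega> / real n) \<le> sqrt (2 * V (floor_sqrt n) \<omega>)) sequentially"
      unfolding eventually_sequentially by (intro exI[of _ 1]) simp
    from Lim_null_comparison[OF this lim] show ?case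
      by (simp add: s_def)
  qed
qed

end

section \<open>Conditional distributions\<close>

lemma subalgebra_sigma_finite:
  assumes "prob_space M" "subalgebra M F"
  shows "sigma_finite_subalgebra M F"
  using assms by (intro finite_measure_subalgebra_is_sigma_finite)
    (simp add: finite_measure_subalgebra_def finite_measure_subalgebra_axioms_def prob_space_def)

text \<open>
  The defining property for indicators extends to nonnegative measurable functions by the
  standard machine.
\<close>

lemma is_cond_distr_nn_integral:
  assumes M: "prob_space M" "subalgebra M F" and Y[measurable]: "Y \<in> borel_measurable M"
    and \<kappa>: "is_cond_distr M F Y \<kappa>"
    and A: "A \<in> sets F" and g: "g \<in> borel_measurable borel"
  shows "(\<integral>\<^sup>+\<omega>. indicator A \<omega> * g (Y \<omega>) \<partial>M) = (\<integral>\<^sup>+\<omega>. indicator A \<omega> * (\<integral>\<^sup>+y. g y \<partial>\<kappa> \<omega>) \<partial>M)"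
proof -
  interpret prob_space M by fact
  interpret sigma_finite_subalgebra M F by (rule subalgebra_sigma_finite[OF M])
  have "\<kappa> \<in> F \<rightarrow>\<^sub>M prob_algebra borel"
    using \<kappa> by (simp add: is_cond_distr_def)
  from measurable_from_subalg[OF M(2) this] have \<kappa>M: "\<kappa> \<in> M \<rightarrow>\<^sub>M prob_algebra borel" .
  then have [measurable]: "\<kappa> \<in> M \<rightarrow>\<^sub>M subprob_algebra borel"
    by (rule measurable_prob_algebraD)
  have prob: "prob_space (\<kappa> \<omega>)" and sets: "sets (\<kappa> \<omega>) = sets borel" if "\<omega> \<in> space M" for \<omega>
    using measurable_space[OF \<kappa>M that] by (simp_all add: space_prob_algebra)
  have km: "h \<in> borel_measurable (\<kappa> \<omega>) \<longleftrightarrow> h \<in> borel_measurable borel"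
    if "\<omega> \<in> space M" for h :: "real \<Rightarrow> ennreal" and \<omega>
    by (rule arg_cong[where f = "\<lambda>S. h \<in> S"], rule measurable_cong_sets[OF sets[OF that] refl])
  have [measurable]: "A \<in> sets M"
    using M(2) A by (auto simp: subalgebra_def)
  have meas: "(\<lambda>\<omega>. \<integral>\<^sup>+y. h y \<partial>\<kappa> \<omega>) \<in> borel_measurable M" if "h \<in> borel_measurable borel" for h
    using that by measurable
  show ?thesis
    using g
  proof (induction rule: borel_measurable_induct)
    case (cong f g)
    then show ?case by simp
  next
    case (set B)
    note [measurable] = set
    have ind: "integrable M (\<lambda>\<omega>. indicator A \<omega> * indicator B (Y \<omega>) :: real)"
      by (rule integrable_const_bound[of _ 1]) (auto simp: indicator_def)
    have m: "(\<lambda>\<omega>. measure (\<kappa> \<omega>) B) \<in> borel_measurable M"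
      by measurable
    have "(\<integral>\<^sup>+\<omega>. indicator A \<omega> * indicator B (Y \<omega>) \<partial>M) = (\<integral>\<^sup>+\<omega>. ennreal (indicator A \<omega> * indicator B (Y \<omega>)) \<partial>M)"
      by (intro nn_integral_cong) (auto simp: indicator_def)
    also have "\<dots> = ennreal (expectation (\<lambda>\<omega>. indicator A \<omega> * indicator B (Y \<omega>)))"
      using ind by (intro nn_integral_eq_integral) auto
    also have "expectation (\<lambda>\<omega>. indicator A \<omega> * indicator B (Y \<omega>))
      = expectation (\<lambda>\<omega>. indicator A \<omega> * real_cond_exp M F (\<lambda>\<omega>. indicator B (Y \<omega>)) \<omega>)"
      using ind A by (intro real_cond_exp_intg(2)[symmetric]) auto
    also have "\<dots> = expectation (\<lambda>\<omega>. indicator A \<omega> * measure (\<kappa> \<omega>) B)"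
    proof (rule integral_cong_AE)
      have "AE \<omega> in M. real_cond_exp M F (\<lambda>\<omega>'. indicator B (Y \<omega>')) \<omega> = measure (\<kappa> \<omega>) B"
        using \<kappa> set by (simp add: is_cond_distr_def)
      then show "AE \<omega> in M. indicator A \<omega> * real_cond_exp M F (\<lambda>\<omega>. indicator B (Y \<omega>)) \<omega>
          = indicator A \<omega> * measure (\<kappa> \<omega>) B"
        by eventually_elim simp
    qed (use m in auto)
    also have "ennreal \<dots> = (\<integral>\<^sup>+\<omega>. ennreal (indicator A \<omega> * measure (\<kappa> \<omega>) B) \<partial>M)"
    proof (intro nn_integral_eq_integral[symmetric] integrable_const_bound[of _ 1])
      show "AE \<omega> in M. norm (indicator A \<omega> * measure (\<kappa> \<omega>) B) \<le> 1"
        using prob by (auto simp: indicator_def intro!: AE_I2 prob_space.prob_le_1)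
    qed (use m in auto)
    also have "\<dots> = (\<integral>\<^sup>+\<omega>. indicator A \<omega> * (\<integral>\<^sup>+y. indicator B y \<partial>\<kappa> \<omega>) \<partial>M)"
    proof (intro nn_integral_cong)
      fix \<omega> assume \<omega>: "\<omega> \<in> space M"
      interpret K: prob_space "\<kappa> \<omega>" using prob[OF \<omega>] .
      show "ennreal (indicator A \<omega> * measure (\<kappa> \<omega>) B) = indicator A \<omega> * (\<integral>\<^sup>+y. indicator B y \<partial>\<kappa> \<omega>)"
        using set sets[OF \<omega>] by (auto simp: indicator_def[of A] K.emeasure_eq_measure)
    qed
    finally show ?case .
  next
    case (mult u c)
    note [measurable] = mult.hyps(2)
    have "(\<integral>\<^sup>+\<omega>. indicator A \<omega> * (c * u (Y \<omega>)) \<partial>M) = c * (\<integral>\<^sup>+\<omega>. indicator A \<omega> * u (Y \<omega>) \<partial>M)"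
      by (subst nn_integral_cmult[symmetric]) (auto simp: mult_ac)
    also have "\<dots> = (\<integral>\<^sup>+\<omega>. indicator A \<omega> * (c * (\<integral>\<^sup>+y. u y \<partial>\<kappa> \<omega>)) \<partial>M)"
      unfolding mult.IH by (subst nn_integral_cmult[symmetric]) (auto simp: mult_ac meas)
    also have "\<dots> = (\<integral>\<^sup>+\<omega>. indicator A \<omega> * (\<integral>\<^sup>+y. c * u y \<partial>\<kappa> \<omega>) \<partial>M)"
      using mult.hyps(2) sets by (intro nn_integral_cong arg_cong2[where f = "(*)"] refl nn_integral_cmult[symmetric])
        (simp add: km)
    finally show ?case .
  next
    case (add u v)
    note [measurable] = add.hyps(1,3)
    have "(\<integral>\<^sup>+\<omega>. indicator A \<omega> * (v (Y \<omega>) + u (Y \<omega>)) \<partial>M)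
      = (\<integral>\<^sup>+\<omega>. indicator A \<omega> * v (Y \<omega>) \<partial>M) + (\<integral>\<^sup>+\<omega>. indicator A \<omega> * u (Y \<omega>) \<partial>M)"
      by (subst nn_integral_add[symmetric]) (auto simp: distrib_left)
    also have "\<dots> = (\<integral>\<^sup>+\<omega>. indicator A \<omega> * ((\<integral>\<^sup>+y. v y \<partial>\<kappa> \<omega>) + (\<integral>\<^sup>+y. u y \<partial>\<kappa> \<omega>)) \<partial>M)"
      unfolding add.IH by (subst nn_integral_add[symmetric]) (auto simp: distrib_left meas)
    also have "\<dots> = (\<integral>\<^sup>+\<omega>. indicator A \<omega> * (\<integral>\<^sup>+y. v y + u y \<partial>\<kappa> \<omega>) \<partial>M)"
      using add.hyps(1,3) sets by (intro nn_integral_cong arg_cong2[where f = "(*)"] refl nn_integral_add[symmetric])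
        (simp_all add: km)
    finally show ?case by simp
  next
    case (seq U)
    note [measurable] = seq.hyps(1)
    have inc: "incseq (\<lambda>i. U i y)" for y
      using seq.hyps(3) by (auto simp: incseq_def le_fun_def)
    have "(\<integral>\<^sup>+\<omega>. indicator A \<omega> * (SUP i. U i) (Y \<omega>) \<partial>M) = (\<integral>\<^sup>+\<omega>. (SUP i. indicator A \<omega> * U i (Y \<omega>)) \<partial>M)"
      by (intro nn_integral_cong) (simp add: SUP_mult_left_ennreal image_comp)
    also have "\<dots> = (SUP i. \<integral>\<^sup>+\<omega>. indicator A \<omega> * U i (Y \<omega>) \<partial>M)"
      using inc by (intro nn_integral_monotone_convergence_SUP) (auto simp: incseq_def le_fun_def intro!: mult_left_mono)
    also have "\<dots> = (SUP i. \<integral>\<^sup>+\<omega>. indicator A \<omega> * (\<integral>\<^sup>+y. U i y \<partial>\<kappa> \<omega>) \<partial>M)"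
      by (simp add: seq.IH)
    also have "\<dots> = (\<integral>\<^sup>+\<omega>. (SUP i. indicator A \<omega> * (\<integral>\<^sup>+y. U i y \<partial>\<kappa> \<omega>)) \<partial>M)"
      using inc by (intro nn_integral_monotone_convergence_SUP[symmetric])
         (auto simp: incseq_def le_fun_def meas intro!: mult_left_mono nn_integral_mono)
    also have "\<dots> = (\<integral>\<^sup>+\<omega>. indicator A \<omega> * (\<integral>\<^sup>+y. (SUP i. U i) y \<partial>\<kappa> \<omega>) \<partial>M)"
    proof (intro nn_integral_cong)
      fix \<omega> assume \<omega>: "\<omega> \<in> space M"
      have "(\<integral>\<^sup>+y. (SUP i. U i y) \<partial>\<kappa> \<omega>) = (SUP i. \<integral>\<^sup>+y. U i y \<partial>\<kappa> \<omega>)"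
        using seq.hyps(3) seq.hyps(1) \<omega> by (intro nn_integral_monotone_convergence_SUP) (simp_all add: km)
      then show "(SUP i. indicator A \<omega> * (\<integral>\<^sup>+y. U i y \<partial>\<kappa> \<omega>)) = indicator A \<omega> * (\<integral>\<^sup>+y. (SUP i. U i) y \<partial>\<kappa> \<omega>)"
        by (simp add: SUP_mult_left_ennreal image_comp)
    qed
    finally show ?case .
  qed
qed

text \<open>
  Consequences of a uniform bound on the second moments of the conditional distributions: the
  integrability and the conditional means that the strong law below relies on. The bound on
  the means comes from \<open>\<bar>t\<bar> \<le> 1 + t\<^sup>2\<close>.
\<close>

lemma
  assumes M: "prob_space M" "subalgebra M F" and Y[measurable]: "Y \<in> borel_measurable M"
    and \<kappa>: "is_cond_distr M F Y \<kappa>" and g[measurable]: "(g :: real \<Rightarrow> real) \<in> borel_measurable borel"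
    and g2: "\<And>\<omega>. \<omega> \<in> space M \<Longrightarrow> integrable (\<kappa> \<omega>) (\<lambda>y. (g y)\<^sup>2)"
      "\<And>\<omega>. \<omega> \<in> space M \<Longrightarrow> (\<integral>y. (g y)\<^sup>2 \<partial>\<kappa> \<omega>) \<le> C"
  shows is_cond_distr_second_moment: "integrable M (\<lambda>\<omega>. (g (Y \<omega>))\<^sup>2)"
    and is_cond_distr_mean_measurable: "(\<lambda>\<omega>. \<integral>y. g y \<partial>\<kappa> \<omega>) \<in> borel_measurable F"
    and is_cond_distr_mean_bound: "\<And>\<omega>. \<omega> \<in> space M \<Longrightarrow> \<bar>\<integral>y. g y \<partial>\<kappa> \<omega>\<bar> \<le> 1 + C"
    and is_cond_distr_second_moment_le: "(\<integral>\<omega>. (g (Y \<omega>))\<^sup>2 \<partial>M) \<le> C"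
    and is_cond_distr_cond_exp: "AE \<omega> in M. real_cond_exp M F (\<lambda>\<omega>. g (Y \<omega>)) \<omega> = (\<integral>y. g y \<partial>\<kappa> \<omega>)"
proof -
  interpret prob_space M by fact
  interpret sigma_finite_subalgebra M F by (rule subalgebra_sigma_finite[OF M])
  have \<kappa>F: "\<kappa> \<in> F \<rightarrow>\<^sub>M prob_algebra borel"
    using \<kappa> by (simp add: is_cond_distr_def)
  then have \<kappa>F' [measurable]: "\<kappa> \<in> F \<rightarrow>\<^sub>M subprob_algebra borel"
    by (rule measurable_prob_algebraD)
  have \<kappa>M[measurable]: "\<kappa> \<in> M \<rightarrow>\<^sub>M subprob_algebra borel"
    by (rule measurable_from_subalg[OF M(2) \<kappa>F'])
  have spF: "space F = space M" and setsF: "A \<in> sets F \<Longrightarrow> A \<in> sets M" for A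
    using M(2) by (auto simp: subalgebra_def)
  have prob: "prob_space (\<kappa> \<omega>)" and sets: "sets (\<kappa> \<omega>) = sets borel" if "\<omega> \<in> space M" for \<omega>
    using measurable_space[OF \<kappa>F, of \<omega>] that by (simp_all add: space_prob_algebra spF)
  have km: "h \<in> borel_measurable (\<kappa> \<omega>) \<longleftrightarrow> h \<in> borel_measurable borel"
    if "\<omega> \<in> space M" for h :: "real \<Rightarrow> real" and \<omega>
    by (rule arg_cong[where f = "\<lambda>S. h \<in> S"], rule measurable_cong_sets[OF sets[OF that] refl])
  have C: "C \<ge> 0"
  proof -
    obtain \<omega> where "\<omega> \<in> space M" using not_empty by auto
    show ?thesis
      by (rule order_trans[OF Bochner_Integration.integral_nonneg g2(2)[OF \<open>\<omega> \<in> space M\<close>]]) simp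
  qed
  have UN: "space M \<in> sets F"
    using spF by (metis sets.top)
  show meas_mean: "(\<lambda>\<omega>. \<integral>y. g y \<partial>\<kappa> \<omega>) \<in> borel_measurable F"
    by measurable
  have gk: "g \<in> borel_measurable (\<kappa> \<omega>)" if "\<omega> \<in> space M" for \<omega>
    using g that by (simp add: km)
  have int: "integrable (\<kappa> \<omega>) g" if \<omega>: "\<omega> \<in> space M" for \<omega>
  proof -
    interpret K: prob_space "\<kappa> \<omega>" by (rule prob[OF \<omega>])
    show ?thesis by (rule K.square_integrable_imp_integrable[OF gk[OF \<omega>] g2(1)[OF \<omega>]])
  qed
  have abs_le: "(\<integral>y. \<bar>g y\<bar> \<partial>\<kappa> \<omega>) \<le> 1 + C" if \<omega>: "\<omega> \<in> space M" for \<omega>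
  proof -
    interpret K: prob_space "\<kappa> \<omega>" by (rule prob[OF \<omega>])
    have le: "\<bar>t\<bar> \<le> 1 + t\<^sup>2" for t :: real
      using sum_squares_bound[of 1 "\<bar>t\<bar>"] by simp
    have "(\<integral>y. \<bar>g y\<bar> \<partial>\<kappa> \<omega>) \<le> (\<integral>y. 1 + (g y)\<^sup>2 \<partial>\<kappa> \<omega>)"
      using int[OF \<omega>] g2(1)[OF \<omega>] le by (intro integral_mono) auto
    also have "\<dots> \<le> 1 + C"
      using g2[OF \<omega>] by (simp add: K.prob_space)
    finally show ?thesis .
  qed
  show mean_bound: "\<bar>\<integral>y. g y \<partial>\<kappa> \<omega>\<bar> \<le> 1 + C" if \<omega>: "\<omega> \<in> space M" for \<omega>
    using abs_le[OF \<omega>] integral_abs_bound[of "\<kappa> \<omega>" g] by linarith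
  have "(\<integral>\<^sup>+\<omega>. ennreal ((g (Y \<omega>))\<^sup>2) \<partial>M) = (\<integral>\<^sup>+\<omega>. indicator (space M) \<omega> * ennreal ((g (Y \<omega>))\<^sup>2) \<partial>M)"
    by (intro nn_integral_cong) simp
  also have "\<dots> = (\<integral>\<^sup>+\<omega>. indicator (space M) \<omega> * (\<integral>\<^sup>+y. ennreal ((g y)\<^sup>2) \<partial>\<kappa> \<omega>) \<partial>M)"
    by (rule is_cond_distr_nn_integral[OF M Y \<kappa> UN]) measurable
  also have "\<dots> \<le> (\<integral>\<^sup>+\<omega>. ennreal C \<partial>M)"
    using g2 by (intro nn_integral_mono) (simp add: nn_integral_eq_integral ennreal_leI)
  finally have le: "(\<integral>\<^sup>+\<omega>. ennreal ((g (Y \<omega>))\<^sup>2) \<partial>M) \<le> ennreal C"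
    by (simp add: emeasure_space_1)
  show int2: "integrable M (\<lambda>\<omega>. (g (Y \<omega>))\<^sup>2)"
    by (rule integrableI_bounded) (use le in \<open>auto simp: order_le_less_trans\<close>)
  show "(\<integral>\<omega>. (g (Y \<omega>))\<^sup>2 \<partial>M) \<le> C"
    using le int2 C by (simp add: nn_integral_eq_integral)
  have intg: "integrable M (\<lambda>\<omega>. g (Y \<omega>))"
    by (rule square_integrable_imp_integrable[OF _ int2]) measurable
  have hk: "integrable (\<kappa> \<omega>) h"
    if "h \<in> borel_measurable borel" and "\<And>y. 0 \<le> h y" "\<And>y. h y \<le> \<bar>g y\<bar>" and \<omega>: "\<omega> \<in> space M" for h \<omega>
    using that by (intro Bochner_Integration.integrable_bound[OF int[OF \<omega>]]) (auto simp: km)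
  \<comment> \<open>The claim for functions between \<open>0\<close> and \<open>\<bar>g\<bar>\<close>, to be applied to the positive and the negative part of \<open>g\<close>.\<close>
  have half: "(\<integral>\<omega>. indicator A \<omega> * h (Y \<omega>) \<partial>M) = (\<integral>\<omega>. indicator A \<omega> * (\<integral>y. h y \<partial>\<kappa> \<omega>) \<partial>M)"
    if A: "A \<in> sets F" and h[measurable]: "h \<in> borel_measurable borel" and h_le: "\<And>y. 0 \<le> h y" "\<And>y. h y \<le> \<bar>g y\<bar>" for A h
  proof -
    note [measurable] = setsF[OF A]
    have "(\<integral>\<omega>. indicator A \<omega> * h (Y \<omega>) \<partial>M) = enn2real (\<integral>\<^sup>+\<omega>. ennreal (indicator A \<omega> * h (Y \<omega>)) \<partial>M)"
      using h_le by (intro integral_eq_nn_integral) auto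
    also have "(\<integral>\<^sup>+\<omega>. ennreal (indicator A \<omega> * h (Y \<omega>)) \<partial>M) = (\<integral>\<^sup>+\<omega>. indicator A \<omega> * ennreal (h (Y \<omega>)) \<partial>M)"
      by (intro nn_integral_cong) (auto simp: indicator_def)
    also have "\<dots> = (\<integral>\<^sup>+\<omega>. indicator A \<omega> * (\<integral>\<^sup>+y. ennreal (h y) \<partial>\<kappa> \<omega>) \<partial>M)"
      by (rule is_cond_distr_nn_integral[OF M Y \<kappa> A]) measurable
    also have "\<dots> = (\<integral>\<^sup>+\<omega>. ennreal (indicator A \<omega> * (\<integral>y. h y \<partial>\<kappa> \<omega>)) \<partial>M)"
      using hk[OF h h_le] h_le by (intro nn_integral_cong) (simp add: nn_integral_eq_integral indicator_def)
    also have "enn2real \<dots> = (\<integral>\<omega>. indicator A \<omega> * (\<integral>y. h y \<partial>\<kappa> \<omega>) \<partial>M)"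
      using h_le by (intro integral_eq_nn_integral[symmetric]) (auto intro!: Bochner_Integration.integral_nonneg)
    finally show ?thesis .
  qed
  show "AE \<omega> in M. real_cond_exp M F (\<lambda>\<omega>. g (Y \<omega>)) \<omega> = (\<integral>y. g y \<partial>\<kappa> \<omega>)"
  proof (rule real_cond_exp_charact)
    fix A assume A: "A \<in> sets F"
    note [measurable] = setsF[OF A]
    define p where "p y = max (g y) 0" for y
    define m where "m y = max (- g y) 0" for y
    have [measurable]: "p \<in> borel_measurable borel" "m \<in> borel_measurable borel"
      unfolding p_def m_def by measurable
    have bnd: "0 \<le> p y" "p y \<le> \<bar>g y\<bar>" "0 \<le> m y" "m y \<le> \<bar>g y\<bar>" for y
      by (auto simp: p_def m_def max_def)
    have split: "g = (\<lambda>y. p y - m y)"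
      by (auto simp: p_def m_def max_def)
    have intY: "integrable M (\<lambda>\<omega>. indicator A \<omega> * h (Y \<omega>))"
      if [measurable]: "h \<in> borel_measurable borel" and h_le: "\<And>y. 0 \<le> h y" "\<And>y. h y \<le> \<bar>g y\<bar>" for h
      using h_le by (intro Bochner_Integration.integrable_bound[OF intg]) (auto simp: indicator_def)
    have intk: "integrable M (\<lambda>\<omega>. indicator A \<omega> * (\<integral>y. h y \<partial>\<kappa> \<omega>))"
      if [measurable]: "h \<in> borel_measurable borel" and h_le: "\<And>y. 0 \<le> h y" "\<And>y. h y \<le> \<bar>g y\<bar>" for h
    proof (rule integrable_const_bound[of _ "1 + C"])
      show "AE \<omega> in M. norm (indicator A \<omega> * (\<integral>y. h y \<partial>\<kappa> \<omega>)) \<le> 1 + C"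
      proof (rule AE_I2)
        fix \<omega> assume \<omega>: "\<omega> \<in> space M"
        have "(\<integral>y. h y \<partial>\<kappa> \<omega>) \<le> (\<integral>y. \<bar>g y\<bar> \<partial>\<kappa> \<omega>)"
          using hk[OF that \<omega>] int[OF \<omega>] h_le by (intro integral_mono) auto
        moreover have "0 \<le> (\<integral>y. h y \<partial>\<kappa> \<omega>)"
          using h_le by (intro Bochner_Integration.integral_nonneg)
        ultimately show "norm (indicator A \<omega> * (\<integral>y. h y \<partial>\<kappa> \<omega>)) \<le> 1 + C"
          using abs_le[OF \<omega>] C by (auto simp: indicator_def)
      qed
    qed measurable
    have "(\<integral>\<omega>. indicator A \<omega> * g (Y \<omega>) \<partial>M) = (\<integral>\<omega>. indicator A \<omega> * p (Y \<omega>) \<partial>M) - (\<integral>\<omega>. indicator A \<omega> * m (Y \<omega>) \<partial>M)"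
      using intY[OF _ bnd(1,2)] intY[OF _ bnd(3,4)]
      by (subst Bochner_Integration.integral_diff[symmetric]) (auto simp: split right_diff_distrib)
    also have "\<dots> = (\<integral>\<omega>. indicator A \<omega> * (\<integral>y. p y \<partial>\<kappa> \<omega>) \<partial>M) - (\<integral>\<omega>. indicator A \<omega> * (\<integral>y. m y \<partial>\<kappa> \<omega>) \<partial>M)"
      using half[OF A _ bnd(1,2)] half[OF A _ bnd(3,4)] by simp
    also have "\<dots> = (\<integral>\<omega>. indicator A \<omega> * ((\<integral>y. p y \<partial>\<kappa> \<omega>) - (\<integral>y. m y \<partial>\<kappa> \<omega>)) \<partial>M)"
      using intk[OF _ bnd(1,2)] intk[OF _ bnd(3,4)]
      by (subst Bochner_Integration.integral_diff[symmetric]) (auto simp: right_diff_distrib)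
    also have "\<dots> = (\<integral>\<omega>. indicator A \<omega> * (\<integral>y. g y \<partial>\<kappa> \<omega>) \<partial>M)"
      using hk[OF _ bnd(1,2)] hk[OF _ bnd(3,4)]
      by (intro Bochner_Integration.integral_cong refl) (simp add: split)
    finally show "(\<integral>\<omega>\<in>A. g (Y \<omega>) \<partial>M) = (\<integral>\<omega>\<in>A. (\<integral>y. g y \<partial>\<kappa> \<omega>) \<partial>M)"
      by (simp add: set_lebesgue_integral_def)
  next
    show "integrable M (\<lambda>\<omega>. \<integral>y. g y \<partial>\<kappa> \<omega>)"
      using mean_bound by (intro integrable_const_bound[of _ "1 + C"] AE_I2) auto
  qed (use intg in auto)
qed

lemma is_cond_distr_AE_not_in_null_set:
  assumes M: "prob_space M" "subalgebra M F" and Y: "Y \<in> borel_measurable M"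
    and \<kappa>: "is_cond_distr M F Y \<kappa>"
    and N: "N \<in> sets borel" "\<And>\<omega>. \<omega> \<in> space M \<Longrightarrow> measure (\<kappa> \<omega>) N = 0"
  shows "AE \<omega> in M. Y \<omega> \<notin> N"
proof -
  interpret prob_space M by fact
  interpret sigma_finite_subalgebra M F by (rule subalgebra_sigma_finite[OF M])
  note [measurable] = Y N(1)
  have int: "integrable M (\<lambda>\<omega>. indicator N (Y \<omega>) :: real)"
    by (rule integrable_const_bound[of _ 1]) (auto simp: indicator_def)
  have "AE \<omega> in M. real_cond_exp M F (\<lambda>\<omega>. indicator N (Y \<omega>)) \<omega> = measure (\<kappa> \<omega>) N"
    using \<kappa> N(1) by (simp add: is_cond_distr_def)
  then have "AE \<omega> in M. real_cond_exp M F (\<lambda>\<omega>. indicator N (Y \<omega>)) \<omega> = 0"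
    using AE_space by eventually_elim (simp add: N(2))
  then have "(\<integral>\<omega>. indicator N (Y \<omega>) \<partial>M) = (0::real)"
    using real_cond_exp_int(2)[OF int] integral_eq_zero_AE by metis
  then have "AE \<omega> in M. indicator N (Y \<omega>) = (0::real)"
    using integral_nonneg_eq_0_iff_AE[OF int] by simp
  then show ?thesis
    by eventually_elim (simp add: indicator_def split: if_splits)
qed

text \<open>
  A strong law for \<open>g (Y\<^sub>i)\<close>, centered at its conditional mean given the past and multiplied by
  weights that are known from the past. The terms are orthogonal: in the product of the terms \<open>i < j\<close>
  everything except the centered \<open>g (Y\<^sub>j)\<close> is known at time \<open>j - 1\<close>. Their second moments are bounded,
  so the strong law for orthogonal variables applies.
\<close>

lemma conditionally_centered_averages_tendsto_0:
  fixes W :: "nat \<Rightarrow> 'w \<Rightarrow> real" and g :: "real \<Rightarrow> real"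
  assumes M: "prob_space M" and F: "filtration (space M) F" "\<And>i. subalgebra M (F i)"
    and Y: "\<And>i. i \<ge> 1 \<Longrightarrow> Y i \<in> F i \<rightarrow>\<^sub>M borel"
    and \<kappa>: "\<And>i. i \<ge> 1 \<Longrightarrow> is_cond_distr M (F (i - 1)) (Y i) (\<kappa> i)"
    and g[measurable]: "g \<in> borel_measurable borel"
    and g2: "\<And>i \<omega>. i \<ge> 1 \<Longrightarrow> \<omega> \<in> space M \<Longrightarrow> integrable (\<kappa> i \<omega>) (\<lambda>y. (g y)\<^sup>2)"
      "\<And>i \<omega>. i \<ge> 1 \<Longrightarrow> \<omega> \<in> space M \<Longrightarrow> (\<integral>y. (g y)\<^sup>2 \<partial>\<kappa> i \<omega>) \<le> C"
    and W: "\<And>i. i \<ge> 1 \<Longrightarrow> W i \<in> borel_measurable (F (i - 1))"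
      "\<And>i \<omega>. i \<ge> 1 \<Longrightarrow> \<omega> \<in> space M \<Longrightarrow> \<bar>W i \<omega>\<bar> \<le> B"
  shows "AE \<omega> in M. (\<lambda>n. (\<Sum>i=1..n. W i \<omega> * (g (Y i \<omega>) - (\<integral>y. g y \<partial>\<kappa> i \<omega>))) / real n) \<longlonglongrightarrow> 0"
proof -
  interpret prob_space M by fact
  interpret sf: sigma_finite_subalgebra M "F i" for i
    by (rule subalgebra_sigma_finite[OF M F(2)])
  have F_mono: "f \<in> borel_measurable (F j)" if "f \<in> borel_measurable (F i)" "i \<le> j" for f :: "'w \<Rightarrow> real" and i j
    using that filtration.sets_F_mono[OF F(1) that(2)] filtration.space_F[OF F(1)]
    by (intro measurable_from_subalg[OF _ that(1)]) (simp add: subalgebra_def)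
  have FM: "f \<in> borel_measurable M" if "f \<in> borel_measurable (F i)" for f :: "'w \<Rightarrow> real" and i
    by (rule measurable_from_subalg[OF F(2) that])
  have YM: "Y i \<in> borel_measurable M" if "i \<ge> 1" for i
    using FM[OF Y[OF that]] .
  define m where "m i \<omega> = (\<integral>y. g y \<partial>\<kappa> i \<omega>)" for i \<omega>
  define Z where "Z i \<omega> = W i \<omega> * (g (Y i \<omega>) - m i \<omega>)" for i \<omega>
  have mF: "m i \<in> borel_measurable (F (i - 1))" if "i \<ge> 1" for i
    unfolding m_def[abs_def] by (rule is_cond_distr_mean_measurable[OF M F(2) YM[OF that] \<kappa>[OF that] g g2[OF that]])
  have m_bound: "\<bar>m i \<omega>\<bar> \<le> 1 + C" if "i \<ge> 1" "\<omega> \<in> space M" for i \<omega>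
    unfolding m_def by (rule is_cond_distr_mean_bound[OF M F(2) YM[OF that(1)] \<kappa>[OF that(1)] g g2[OF that(1)] that(2)])
  have gY2: "integrable M (\<lambda>\<omega>. (g (Y i \<omega>))\<^sup>2)" if "i \<ge> 1" for i
    by (rule is_cond_distr_second_moment[OF M F(2) YM[OF that] \<kappa>[OF that] g g2[OF that]])
  have gY2_le: "(\<integral>\<omega>. (g (Y i \<omega>))\<^sup>2 \<partial>M) \<le> C" if "i \<ge> 1" for i
    by (rule is_cond_distr_second_moment_le[OF M F(2) YM[OF that] \<kappa>[OF that] g g2[OF that]])
  have gYF: "(\<lambda>\<omega>. g (Y i \<omega>)) \<in> borel_measurable (F i)" if "i \<ge> 1" for i
    using measurable_compose[OF Y[OF that] g] .
  have ZF: "Z i \<in> borel_measurable (F i)" if "i \<ge> 1" for i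
    unfolding Z_def[abs_def]
    using F_mono[OF W(1)[OF that], of i] F_mono[OF mF[OF that], of i] gYF[OF that] by auto
  have Z2_le: "(Z i \<omega>)\<^sup>2 \<le> B\<^sup>2 * (2 * (g (Y i \<omega>))\<^sup>2 + 2 * (1 + C)\<^sup>2)" if "i \<ge> 1" "\<omega> \<in> space M" for i \<omega>
  proof -
    have "(g (Y i \<omega>) - m i \<omega>)\<^sup>2 \<le> 2 * (g (Y i \<omega>))\<^sup>2 + 2 * (m i \<omega>)\<^sup>2"
      using zero_le_power2[of "g (Y i \<omega>) + m i \<omega>"] by (simp add: power2_eq_square algebra_simps)
    also have "(m i \<omega>)\<^sup>2 \<le> (1 + C)\<^sup>2"
      using power_mono[OF m_bound[OF that], of 2] by simp
    finally have "(g (Y i \<omega>) - m i \<omega>)\<^sup>2 \<le> 2 * (g (Y i \<omega>))\<^sup>2 + 2 * (1 + C)\<^sup>2" by simp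
    moreover have "(W i \<omega>)\<^sup>2 \<le> B\<^sup>2"
      using power_mono[OF W(2)[OF that], of 2] by simp
    ultimately show ?thesis
      unfolding Z_def power_mult_distrib by (intro mult_mono) auto
  qed
  have Z2: "integrable M (\<lambda>\<omega>. (Z i \<omega>)\<^sup>2)" if "i \<ge> 1" for i
  proof (rule Bochner_Integration.integrable_bound)
    show "integrable M (\<lambda>\<omega>. B\<^sup>2 * (2 * (g (Y i \<omega>))\<^sup>2 + 2 * (1 + C)\<^sup>2))"
      using gY2[OF that] by auto
    show "AE \<omega> in M. norm ((Z i \<omega>)\<^sup>2) \<le> norm (B\<^sup>2 * (2 * (g (Y i \<omega>))\<^sup>2 + 2 * (1 + C)\<^sup>2))"
      using Z2_le[OF that] by (intro AE_I2) (auto intro: order_trans[OF _ abs_ge_self])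
  qed (use FM[OF ZF[OF that]] in measurable)
  have ZZ: "integrable M (\<lambda>\<omega>. Z i \<omega> * Z j \<omega>)" if ij: "i \<ge> 1" "j \<ge> 1" for i j
  proof (rule Bochner_Integration.integrable_bound)
    show "integrable M (\<lambda>\<omega>. (Z i \<omega>)\<^sup>2 + (Z j \<omega>)\<^sup>2)"
      using Z2 ij by auto
    have "\<bar>a * b\<bar> \<le> a\<^sup>2 + b\<^sup>2" for a b :: real
      using sum_squares_bound[of "\<bar>a\<bar>" "\<bar>b\<bar>"] abs_ge_zero[of "a * b"]
      unfolding abs_mult power2_abs by linarith
    then show "AE \<omega> in M. norm (Z i \<omega> * Z j \<omega>) \<le> norm ((Z i \<omega>)\<^sup>2 + (Z j \<omega>)\<^sup>2)"
      by (intro AE_I2) (simp del: abs_mult)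
  qed (use FM[OF ZF[OF ij(1)]] FM[OF ZF[OF ij(2)]] in measurable)
  have orth: "expectation (\<lambda>\<omega>. Z i \<omega> * Z j \<omega>) = 0" if ij: "i \<ge> 1" "i < j" for i j
  proof -
    have j: "j \<ge> 1" using ij by simp
    have ZWF: "(\<lambda>\<omega>. Z i \<omega> * W j \<omega>) \<in> borel_measurable (F (j - 1))"
      using F_mono[OF ZF[OF ij(1)], of "j - 1"] W(1)[OF j] ij by auto
    have [measurable]: "(\<lambda>\<omega>. g (Y j \<omega>)) \<in> borel_measurable M" "m j \<in> borel_measurable M"
      using FM[OF gYF[OF j]] FM[OF mF[OF j]] by auto
    have intg: "integrable M (\<lambda>\<omega>. g (Y j \<omega>))"
      by (rule square_integrable_imp_integrable[OF _ gY2[OF j]]) measurable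
    have intm: "integrable M (m j)"
      using m_bound[OF j] by (intro integrable_const_bound[of _ "1 + C"] AE_I2) auto
    have eq: "Z i \<omega> * Z j \<omega> = (Z i \<omega> * W j \<omega>) * (g (Y j \<omega>) - m j \<omega>)" for \<omega>
      by (simp add: Z_def)
    have "expectation (\<lambda>\<omega>. Z i \<omega> * Z j \<omega>)
      = expectation (\<lambda>\<omega>. (Z i \<omega> * W j \<omega>) * real_cond_exp M (F (j - 1)) (\<lambda>\<omega>. g (Y j \<omega>) - m j \<omega>) \<omega>)"
      unfolding eq using ZZ[OF ij(1) j, unfolded eq] by (intro sf.real_cond_exp_intg(2)[symmetric] ZWF) auto
    also have "\<dots> = expectation (\<lambda>\<omega>. 0)"
    proof (rule integral_cong_AE)
      have "AE \<omega> in M. real_cond_exp M (F (j - 1)) (\<lambda>\<omega>. g (Y j \<omega>)) \<omega> = m j \<omega>"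
        unfolding m_def by (rule is_cond_distr_cond_exp[OF M F(2) YM[OF j] \<kappa>[OF j] g g2[OF j]])
      moreover have "AE \<omega> in M. real_cond_exp M (F (j - 1)) (m j) \<omega> = m j \<omega>"
        using intm mF[OF j] by (rule sf.real_cond_exp_F_meas)
      moreover have "AE \<omega> in M. real_cond_exp M (F (j - 1)) (\<lambda>\<omega>. g (Y j \<omega>) - m j \<omega>) \<omega>
          = real_cond_exp M (F (j - 1)) (\<lambda>\<omega>. g (Y j \<omega>)) \<omega> - real_cond_exp M (F (j - 1)) (m j) \<omega>"
        using intg intm by (rule sf.real_cond_exp_diff)
      ultimately show "AE \<omega> in M. Z i \<omega> * W j \<omega> * real_cond_exp M (F (j - 1)) (\<lambda>\<omega>. g (Y j \<omega>) - m j \<omega>) \<omega> = 0"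
        by eventually_elim simp
    next
      show "(\<lambda>\<omega>. Z i \<omega> * W j \<omega> * real_cond_exp M (F (j - 1)) (\<lambda>\<omega>. g (Y j \<omega>) - m j \<omega>) \<omega>) \<in> borel_measurable M"
        using FM[OF ZWF] by measurable
    qed simp
    finally show ?thesis by simp
  qed
  have "expectation (\<lambda>\<omega>. (Z i \<omega>)\<^sup>2) \<le> B\<^sup>2 * (2 * C + 2 * (1 + C)\<^sup>2)" if i: "i \<ge> 1" for i
  proof -
    have "expectation (\<lambda>\<omega>. (Z i \<omega>)\<^sup>2) \<le> expectation (\<lambda>\<omega>. B\<^sup>2 * (2 * (g (Y i \<omega>))\<^sup>2 + 2 * (1 + C)\<^sup>2))"
      using Z2[OF i] Z2_le[OF i] gY2[OF i] by (intro integral_mono) auto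
    also have "\<dots> = B\<^sup>2 * (2 * expectation (\<lambda>\<omega>. (g (Y i \<omega>))\<^sup>2) + 2 * (1 + C)\<^sup>2)"
      using gY2[OF i] by (simp add: prob_space)
    also have "\<dots> \<le> B\<^sup>2 * (2 * C + 2 * (1 + C)\<^sup>2)"
      using gY2_le[OF i] by (intro mult_left_mono add_mono) auto
    finally show ?thesis .
  qed
  from strong_law_orthogonal[OF ZZ orth this] show ?thesis
    by (simp add: Z_def m_def)
qed

section \<open>Canonical parameter and exponential family\<close>

lemma canonical_expfamD:
  assumes "canonical_expfam J \<nu> K b"
  shows "open J" "is_interval J" "\<tau> \<in> J \<Longrightarrow> deriv (deriv b) \<tau> > 0"
  using assms unfolding canonical_expfam_def by blast+

lemma canonical_expfam_derivs:
  assumes "canonical_expfam J \<nu> K b" "\<tau> \<in> J"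
  shows "(b has_real_derivative deriv b \<tau>) (at \<tau>)"
    "(deriv b has_real_derivative deriv (deriv b) \<tau>) (at \<tau>)"
    "isCont (deriv (deriv b)) \<tau>"
proof -
  have "(deriv ^^ k) b differentiable (at \<tau>)" for k
    using assms by (auto simp: canonical_expfam_def)
  from this[of 0] this[of 1] this[of 2]
  show "(b has_real_derivative deriv b \<tau>) (at \<tau>)"
    "(deriv b has_real_derivative deriv (deriv b) \<tau>) (at \<tau>)"
    "isCont (deriv (deriv b)) \<tau>"
    by (simp_all add: DERIV_deriv_iff_real_differentiable numeral_2_eq_2 differentiable_imp_continuous_within)
qed

lemma canonical_expfam_inj_on_deriv:
  assumes "canonical_expfam J \<nu> K b"
  shows "inj_on (deriv b) J"
proof (rule linorder_inj_onI')
  fix x y assume xy: "x \<in> J" "y \<in> J" "x < y"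
  have J: "z \<in> J" if "x \<le> z" "z \<le> y" for z
    using canonical_expfamD(2)[OF assms] xy that unfolding is_interval_1 by blast
  have "deriv b x < deriv b y"
  proof (rule DERIV_pos_imp_increasing[OF xy(3)])
    fix z assume "x \<le> z" "z \<le> y"
    then show "\<exists>d. DERIV (deriv b) z :> d \<and> d > 0"
      using canonical_expfam_derivs(2)[OF assms J] canonical_expfamD(3)[OF assms J] by blast
  qed
  then show "deriv b x \<noteq> deriv b y" by simp
qed

lemma C1_differentiable_on_open_deriv:
  fixes G :: "real \<Rightarrow> real"
  assumes "G C1_differentiable_on I" 
  shows "u \<in> I \<Longrightarrow> (G has_real_derivative deriv G u) (at u)" "continuous_on I (deriv G)"
proof -
  obtain D where D: "\<And>x. x \<in> I \<Longrightarrow> (G has_vector_derivative D x) (at x)" "continuous_on I D"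
    using assms by (auto simp: C1_differentiable_on_def)
  have D': "(G has_real_derivative D x) (at x)" if "x \<in> I" for x
    using D(1)[OF that] by (simp add: has_real_derivative_iff_has_vector_derivative)
  then have eq: "deriv G x = D x" if "x \<in> I" for x
    using that by (blast intro: DERIV_imp_deriv)
  show "u \<in> I \<Longrightarrow> (G has_real_derivative deriv G u) (at u)"
    using D' eq by simp
  show "continuous_on I (deriv G)"
    using D(2) eq by (simp cong: continuous_on_cong)
qed

lemma canonical_param_inverse:
  assumes "G ` I \<subseteq> deriv b ` J" "u \<in> I"
  shows "canonical_param J b G u \<in> J" "deriv b (canonical_param J b G u) = G u"
  using assms by (auto simp: canonical_param_def image_subset_iff inv_into_into f_inv_into_f)

lemma canonical_param_has_derivative:
  assumes expfam: "canonical_expfam J \<nu> K b" and G: "G C1_differentiable_on I" "G ` I \<subseteq> deriv b ` J" and u: "u \<in> I"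
  shows "(canonical_param J b G has_real_derivative deriv G u / deriv (deriv b) (canonical_param J b G u)) (at u)"
proof -
  define t where "t = canonical_param J b G u"
  have t: "t \<in> J" "deriv b t = G u"
    using canonical_param_inverse[OF G(2) u] by (simp_all add: t_def)
  have pos: "deriv (deriv b) t > 0" and J: "open J"
    using canonical_expfamD[OF expfam] t(1) by blast+
  have "(inv_into J (deriv b) has_real_derivative inverse (deriv (deriv b) t)) (at (deriv b t))"
    unfolding has_field_derivative_def
  proof (rule has_derivative_inverse_strong[OF J t(1)])
    show "(deriv b has_derivative (*) (deriv (deriv b) t)) (at t)"
      using canonical_expfam_derivs(2)[OF expfam t(1)] by (simp add: has_field_derivative_def)
    show "(*) (deriv (deriv b) t) \<circ> (*) (inverse (deriv (deriv b) t)) = id"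
      using pos by (auto simp: fun_eq_iff)
    show "continuous_on J (deriv b)"
      by (rule DERIV_continuous_on, rule has_field_derivative_at_within, rule canonical_expfam_derivs(2)[OF expfam])
    show "inv_into J (deriv b) (deriv b z) = z" if "z \<in> J" for z
      using canonical_expfam_inj_on_deriv[OF expfam] that by simp
  qed
  from DERIV_chain2[OF this[unfolded t(2)] C1_differentiable_on_open_deriv(1)[OF G(1) u]]
  show ?thesis
    by (simp add: canonical_param_def[abs_def] t_def divide_inverse mult.commute)
qed

lemma compact_interval_positive_lower_bound:
  fixes h :: "real \<Rightarrow> real"
  assumes "continuous_on {lo..hi} h" "\<And>u. u \<in> {lo..hi} \<Longrightarrow> h u > 0"
  obtains m where "m > 0" "\<And>u. u \<in> {lo..hi} \<Longrightarrow> m \<le> h u"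
proof (cases "lo \<le> hi")
  case True
  then obtain z where "z \<in> {lo..hi}" "\<And>u. u \<in> {lo..hi} \<Longrightarrow> h z \<le> h u"
    using continuous_attains_inf[OF compact_Icc _ assms(1)] by auto
  with assms(2) that show ?thesis by blast
qed (use that[of 1] in auto)

lemma compact_interval_upper_bound:
  fixes h :: "real \<Rightarrow> real"
  assumes "continuous_on {lo..hi} h"
  obtains m where "\<And>u. u \<in> {lo..hi} \<Longrightarrow> h u \<le> m"
proof -
  have "bounded (h ` {lo..hi})"
    by (intro compact_imp_bounded compact_continuous_image assms compact_Icc)
  with that show ?thesis
    by (force simp: bounded_iff abs_le_iff)
qed

lemma expfam_moments:
  assumes "canonical_expfam J \<nu> K b" "\<tau> \<in> J"
  shows "(\<integral>y. y \<partial>expfam_measure \<nu> K b \<tau>) = deriv b \<tau>"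
    "integrable (expfam_measure \<nu> K b \<tau>) (\<lambda>y. y\<^sup>2)"
    "(\<integral>y. y\<^sup>2 \<partial>expfam_measure \<nu> K b \<tau>) = deriv (deriv b) \<tau> + (deriv b \<tau>)\<^sup>2"
proof -
  interpret P: prob_space "expfam_measure \<nu> K b \<tau>"
    using assms by (simp add: canonical_expfam_def)
  have int: "integrable (expfam_measure \<nu> K b \<tau>) (\<lambda>y. y)" "integrable (expfam_measure \<nu> K b \<tau>) (\<lambda>y. y\<^sup>2)"
    and m: "deriv b \<tau> = P.expectation (\<lambda>y. y)" and v: "deriv (deriv b) \<tau> = P.variance (\<lambda>y. y)"
    using assms by (simp_all add: canonical_expfam_def)
  show "(\<integral>y. y \<partial>expfam_measure \<nu> K b \<tau>) = deriv b \<tau>" "integrable (expfam_measure \<nu> K b \<tau>) (\<lambda>y. y\<^sup>2)"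
    using int m by simp_all
  show "(\<integral>y. y\<^sup>2 \<partial>expfam_measure \<nu> K b \<tau>) = deriv (deriv b) \<tau> + (deriv b \<tau>)\<^sup>2"
    using P.variance_eq[OF int] m v by simp
qed

lemma measure_expfam_weight_zero:
  assumes "canonical_expfam J \<nu> K b" "\<tau> \<in> J"
  shows "measure (expfam_measure \<nu> K b \<tau>) {y. K y = 0} = 0"
proof -
  have [measurable]: "K \<in> borel_measurable borel" and sets: "sets \<nu> = sets borel"
    using assms by (auto simp: canonical_expfam_def)
  have [measurable]: "K \<in> borel_measurable \<nu>" "(\<lambda>y. y) \<in> borel_measurable \<nu>"
    by (auto simp: measurable_cong_sets[OF sets refl])
  have B: "{y. K y = 0} \<in> sets \<nu>"
    unfolding sets by measurable
  have "emeasure (expfam_measure \<nu> K b \<tau>) {y. K y = 0}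
      = (\<integral>\<^sup>+y. ennreal (K y * exp (\<tau> * y - b \<tau>)) * indicator {y. K y = 0} y \<partial>\<nu>)"
    unfolding expfam_measure_def by (rule emeasure_density) (use B in measurable)
  also have "\<dots> = (\<integral>\<^sup>+y. 0 \<partial>\<nu>)"
    by (intro nn_integral_cong) (auto simp: indicator_def)
  finally show ?thesis by (simp add: measure_def)
qed

text \<open>
  The linear predictors range in a compact interval, on which all the smooth functions of the model
  are bounded, and the positive ones are bounded away from \<open>0\<close>. The last but one conclusion is the
  identifiability of the model in quantitative form: its right-hand side is the Kullback-Leibler
  divergence of the response distribution at \<open>v\<close> from the one at \<open>u\<close>. As a function of \<open>u\<close> this
  divergence has the derivative \<open>(G u - G v) \<tau>'(u)\<close>, which has the sign of \<open>u - v\<close> and is at least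
  \<open>2 \<gamma> \<bar>u - v\<bar>\<close> in absolute value. The last conclusion bounds the second moment of the response.
\<close>

lemma link_constants:
  fixes J :: "real set" and b G :: "real \<Rightarrow> real" and lo hi :: real
  defines "\<tau> \<equiv> canonical_param J b G"
  assumes expfam: "canonical_expfam J \<nu> K b"
    and G: "G C1_differentiable_on I" "\<And>u. u \<in> I \<Longrightarrow> deriv G u > 0" "G ` I \<subseteq> deriv b ` J"
    and I: "{lo..hi} \<subseteq> I"
  obtains c1 c2 L \<gamma> C where "c1 > 0" "\<gamma> > 0"
    "\<And>u. u \<in> {lo..hi} \<Longrightarrow> c1 \<le> glm_weight J b G u \<and> glm_weight J b G u \<le> c2"
    "\<And>u v. u \<in> {lo..hi} \<Longrightarrow> v \<in> {lo..hi} \<Longrightarrow> \<bar>\<tau> u - \<tau> v\<bar> \<le> L * \<bar>u - v\<bar>"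
    "\<And>u v. u \<in> {lo..hi} \<Longrightarrow> v \<in> {lo..hi} \<Longrightarrow> \<gamma> * (u - v)\<^sup>2 \<le> b (\<tau> u) - b (\<tau> v) - G v * (\<tau> u - \<tau> v)"
    "\<And>u. u \<in> {lo..hi} \<Longrightarrow> deriv (deriv b) (\<tau> u) + (G u)\<^sup>2 \<le> C"
proof -
  define d where "d u = deriv G u / deriv (deriv b) (\<tau> u)" for u
  have \<tau>: "\<tau> u \<in> J" "deriv b (\<tau> u) = G u" "(\<tau> has_real_derivative d u) (at u)" "deriv (deriv b) (\<tau> u) > 0" if "u \<in> I" for u
    using canonical_param_inverse[OF G(3) that] canonical_param_has_derivative[OF expfam G(1,3) that]
      canonical_expfamD(3)[OF expfam] by (auto simp: \<tau>_def d_def)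
  have G': "(G has_real_derivative deriv G u) (at u)" if "u \<in> I" for u
    by (rule C1_differentiable_on_open_deriv(1)[OF G(1) that])
  have cont_\<tau>: "continuous_on {lo..hi} \<tau>"
    by (rule DERIV_continuous_on, rule has_field_derivative_at_within, rule \<tau>(3)) (use I in auto)
  have cont_G: "continuous_on {lo..hi} G"
    by (rule DERIV_continuous_on, rule has_field_derivative_at_within, rule G') (use I in auto)
  have "continuous_on J (deriv (deriv b))"
    using canonical_expfam_derivs(3)[OF expfam] by (simp add: continuous_at_imp_continuous_on)
  then have cont_b: "continuous_on {lo..hi} (\<lambda>u. deriv (deriv b) (\<tau> u))"
    by (rule continuous_on_compose2[OF _ cont_\<tau>]) (use \<tau> I in auto)
  have cont_G': "continuous_on {lo..hi} (deriv G)"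
    using C1_differentiable_on_open_deriv(2)[OF G(1)] I by (rule continuous_on_subset)
  have b_pos: "deriv (deriv b) (\<tau> u) > 0" if "u \<in> {lo..hi}" for u
    using \<tau>(4) that I by auto
  have cont_w: "continuous_on {lo..hi} (glm_weight J b G)"
    unfolding glm_weight_def[abs_def] \<tau>_def[symmetric]
    using b_pos by (intro continuous_intros cont_G' cont_b) (auto simp: order_less_le)
  have cont_d: "continuous_on {lo..hi} d"
    unfolding d_def[abs_def] using b_pos by (intro continuous_intros cont_G' cont_b) (auto simp: order_less_le)
  have w_pos: "glm_weight J b G u > 0" if "u \<in> {lo..hi}" for u
    using b_pos[OF that] G(2) that I by (auto simp: glm_weight_def \<tau>_def)
  have d_pos: "d u > 0" if "u \<in> {lo..hi}" for u
    using b_pos[OF that] G(2) that I by (auto simp: d_def)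
  obtain c1 where c1: "c1 > 0" "\<And>u. u \<in> {lo..hi} \<Longrightarrow> c1 \<le> glm_weight J b G u"
    using compact_interval_positive_lower_bound[OF cont_w w_pos] by blast
  obtain c2 where c2: "\<And>u. u \<in> {lo..hi} \<Longrightarrow> glm_weight J b G u \<le> c2"
    using compact_interval_upper_bound[OF cont_w] by blast
  obtain d1 where d1: "d1 > 0" "\<And>u. u \<in> {lo..hi} \<Longrightarrow> d1 \<le> d u"
    using compact_interval_positive_lower_bound[OF cont_d d_pos] by blast
  obtain L where L: "\<And>u. u \<in> {lo..hi} \<Longrightarrow> d u \<le> L"
    using compact_interval_upper_bound[OF cont_d] by blast
  obtain g1 where g1: "g1 > 0" "\<And>u. u \<in> {lo..hi} \<Longrightarrow> g1 \<le> deriv G u"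
    using compact_interval_positive_lower_bound[OF cont_G'] G(2) I by blast
  have cont_C: "continuous_on {lo..hi} (\<lambda>u. deriv (deriv b) (\<tau> u) + (G u)\<^sup>2)"
    by (intro continuous_intros cont_b cont_G)
  obtain C where C: "\<And>u. u \<in> {lo..hi} \<Longrightarrow> deriv (deriv b) (\<tau> u) + (G u)\<^sup>2 \<le> C"
    using compact_interval_upper_bound[OF cont_C] by blast
  have lip: "\<bar>\<tau> u - \<tau> v\<bar> \<le> L * \<bar>u - v\<bar>" if uv: "u \<in> {lo..hi}" "v \<in> {lo..hi}" for u v
  proof -
    have "norm (\<tau> u - \<tau> v) \<le> L * norm (u - v)"
    proof (rule field_differentiable_bound[OF convex_real_interval(5)[of lo hi]])
      fix z assume z: "z \<in> {lo..hi}"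
      then show "(\<tau> has_field_derivative d z) (at z within {lo..hi})"
        using \<tau>(3) I by (blast intro: has_field_derivative_at_within)
      show "norm (d z) \<le> L"
        using L[OF z] d_pos[OF z] by simp
    qed (use uv in auto)
    then show ?thesis by simp
  qed
  have G_mono: "g1 * (u - v) \<le> G u - G v" if uv: "u \<in> {lo..hi}" "v \<in> {lo..hi}" "v \<le> u" for u v
  proof -
    have "G v - g1 * v \<le> G u - g1 * u"
    proof (rule DERIV_nonneg_imp_nondecreasing[OF uv(3)])
      fix z assume "v \<le> z" "z \<le> u"
      then have z: "z \<in> {lo..hi}" using uv by auto
      show "\<exists>y. ((\<lambda>z. G z - g1 * z) has_real_derivative y) (at z) \<and> 0 \<le> y"
        using g1(2)[OF z] z I by (intro exI[of _ "deriv G z - g1"]) (auto intro!: derivative_eq_intros G')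
    qed
    then show ?thesis by (simp add: algebra_simps)
  qed
  define \<gamma> where "\<gamma> = g1 * d1 / 2"
  have conv: "\<gamma> * (u - v)\<^sup>2 \<le> b (\<tau> u) - b (\<tau> v) - G v * (\<tau> u - \<tau> v)"
    if uv: "u \<in> {lo..hi}" "v \<in> {lo..hi}" for u v
  proof -
    \<comment> \<open>\<open>H\<close> vanishes at \<open>v\<close>; it decreases before \<open>v\<close> and increases after \<open>v\<close>.\<close>
    define H where "H z = b (\<tau> z) - b (\<tau> v) - G v * (\<tau> z - \<tau> v) - \<gamma> * (z - v)\<^sup>2" for z
    have H': "(H has_real_derivative (G z - G v) * d z - g1 * d1 * (z - v)) (at z)" if z: "z \<in> {lo..hi}" for z
    proof -
      have zI: "z \<in> I" using z I by auto
      have "((\<lambda>z. b (\<tau> z)) has_real_derivative G z * d z) (at z)"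
        using DERIV_chain2[OF canonical_expfam_derivs(1)[OF expfam \<tau>(1)[OF zI]] \<tau>(3)[OF zI]] \<tau>(2)[OF zI] by simp
      then show ?thesis
        unfolding H_def[abs_def]
        by (auto intro!: derivative_eq_intros \<tau>(3)[OF zI] simp: \<gamma>_def field_simps)
    qed
    have "H v \<le> H u"
    proof (cases "v \<le> u")
      case True
      show ?thesis
      proof (rule DERIV_nonneg_imp_nondecreasing[OF True])
        fix z assume z: "v \<le> z" "z \<le> u"
        then have z': "z \<in> {lo..hi}" using uv by auto
        have "g1 * (z - v) * d1 \<le> (G z - G v) * d z"
        proof (rule mult_mono)
          have "0 \<le> g1 * (z - v)" using g1(1) z by simp
          then show "0 \<le> G z - G v" using G_mono[OF z' uv(2) z(1)] by linarith
        qed (use G_mono[OF z' uv(2) z(1)] d1(1) d1(2)[OF z'] in auto)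
        then show "\<exists>y. (H has_real_derivative y) (at z) \<and> 0 \<le> y"
          using H'[OF z'] by (intro exI[of _ "(G z - G v) * d z - g1 * d1 * (z - v)"]) (auto simp: algebra_simps)
      qed
    next
      case False
      then have uv': "u \<le> v" by simp
      show ?thesis
      proof (rule DERIV_nonpos_imp_nonincreasing[OF uv'])
        fix z assume z: "u \<le> z" "z \<le> v"
        then have z': "z \<in> {lo..hi}" using uv by auto
        have "g1 * (v - z) * d1 \<le> (G v - G z) * d z"
        proof (rule mult_mono)
          have "0 \<le> g1 * (v - z)" using g1(1) z by simp
          then show "0 \<le> G v - G z" using G_mono[OF uv(2) z' z(2)] by linarith
        qed (use G_mono[OF uv(2) z' z(2)] d1(1) d1(2)[OF z'] in auto)
        then show "\<exists>y. (H has_real_derivative y) (at z) \<and> y \<le> 0"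
          using H'[OF z'] by (intro exI[of _ "(G z - G v) * d z - g1 * d1 * (z - v)"]) (auto simp: algebra_simps)
      qed
    qed
    then show ?thesis by (simp add: H_def)
  qed
  have "\<gamma> > 0" using g1 d1 by (simp add: \<gamma>_def)
  from c1(1) this c1(2) c2 lip conv C show ?thesis
    by (intro that[of c1 \<gamma> c2 L C]) auto
qed

section \<open>Strong consistency\<close>

text \<open>
  Equi-Lipschitz functions that tend to \<open>0\<close> on a dense subset of a compact set do so uniformly.
  The conclusion is put in terms of an arbitrary sequence of points because it is used for the
  values of the estimators along one path.
\<close>

lemma equi_Lipschitz_tendsto_0_along:
  fixes Q :: "nat \<Rightarrow> 'a::metric_space \<Rightarrow> real"
  assumes \<Theta>: "compact \<Theta>" "D \<subseteq> \<Theta>" "\<Theta> \<subseteq> closure D"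
    and pointwise: "\<And>d. d \<in> D \<Longrightarrow> (\<lambda>n. Q n d) \<longlonglongrightarrow> 0"
    and lipschitz: "eventually (\<lambda>n. \<forall>\<theta>\<in>\<Theta>. \<forall>\<theta>'\<in>\<Theta>. \<bar>Q n \<theta> - Q n \<theta>'\<bar> \<le> L * dist \<theta> \<theta>') sequentially"
    and t: "eventually (\<lambda>n. t n \<in> \<Theta>) sequentially"
  shows "(\<lambda>n. Q n (t n)) \<longlonglongrightarrow> 0"
proof (rule tendstoI)
  fix \<epsilon> :: real assume \<epsilon>: "\<epsilon> > 0"
  define \<delta> where "\<delta> = \<epsilon> / (2 * (\<bar>L\<bar> + 1))"
  have \<delta>: "\<delta> > 0" using \<epsilon> by (simp add: \<delta>_def)
  have "\<Theta> \<subseteq> (\<Union>d\<in>D. ball d \<delta>)"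
  proof
    fix \<theta> assume "\<theta> \<in> \<Theta>"
    with \<Theta>(3) \<delta> obtain d where "d \<in> D" "dist d \<theta> < \<delta>"
      by (meson closure_approachable subsetD)
    then show "\<theta> \<in> (\<Union>d\<in>D. ball d \<delta>)" by auto
  qed
  then obtain D' where D': "D' \<subseteq> D" "finite D'" "\<Theta> \<subseteq> (\<Union>d\<in>D'. ball d \<delta>)"
    using compactE_image[OF \<Theta>(1), of D "\<lambda>d. ball d \<delta>"] by blast
  have "eventually (\<lambda>n. \<forall>d\<in>D'. \<bar>Q n d\<bar> < \<epsilon> / 2) sequentially"
  proof (intro eventually_ball_finite ballI)
    fix d assume "d \<in> D'"
    then have "(\<lambda>n. Q n d) \<longlonglongrightarrow> 0"
      using D'(1) pointwise by auto
    then show "eventually (\<lambda>n. \<bar>Q n d\<bar> < \<epsilon> / 2) sequentially"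
      using tendstoD[of "\<lambda>n. Q n d" 0 _ "\<epsilon> / 2"] \<epsilon> by (simp add: dist_real_def)
  qed (rule D')
  with lipschitz t show "eventually (\<lambda>n. dist (Q n (t n)) 0 < \<epsilon>) sequentially"
  proof eventually_elim
    case (elim n)
    then obtain d where d: "d \<in> D'" "dist d (t n) < \<delta>"
      using D'(3) by auto
    have "\<bar>Q n (t n) - Q n d\<bar> \<le> L * dist (t n) d"
      using elim d(1) D'(1) \<Theta>(2) by blast
    also have "\<dots> \<le> (\<bar>L\<bar> + 1) * dist (t n) d"
      by (intro mult_right_mono) auto
    also have "\<dots> \<le> (\<bar>L\<bar> + 1) * \<delta>"
      using d(2) by (intro mult_left_mono) (auto simp: dist_commute)
    also have "\<dots> = \<epsilon> / 2"
      unfolding \<delta>_def by (simp add: field_simps add_nonneg_eq_0_iff)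
    finally show ?case
      using bspec[OF elim(3) d(1)] unfolding dist_real_def by linarith
  qed
qed

theorem theorem3p3:
  fixes M :: "'w measure" and F :: "nat \<Rightarrow> 'w measure"
    and S :: "'x :: metric_space set" and \<Theta> :: "(real ^ 'p) set" and \<theta>bar :: "real ^ 'p"
    and f :: "'x \<Rightarrow> real ^ 'p" and I :: "real set" and G :: "real \<Rightarrow> real"
    and J :: "real set" and \<nu> :: "real measure" and K b :: "real \<Rightarrow> real"
    and X :: "nat \<Rightarrow> 'w \<Rightarrow> 'x" and Y :: "nat \<Rightarrow> 'w \<Rightarrow> real"
    and n_st :: nat
    and est est_mle :: "nat \<Rightarrow> (nat \<Rightarrow> 'x \<times> real) \<Rightarrow> real ^ 'p"
  assumes S: "compact S" "S \<noteq> {}"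
    and \<Theta>: "compact \<Theta>" "\<theta>bar \<in> \<Theta>"
    and f: "continuous_on S f" "span (f ` S) = UNIV"
    and I: "open I" "is_interval I" "\<And>x \<theta>. x \<in> S \<Longrightarrow> \<theta> \<in> \<Theta> \<Longrightarrow> f x \<bullet> \<theta> \<in> I"
    and G: "G C1_differentiable_on I" "\<And>u. u \<in> I \<Longrightarrow> deriv G u > 0"
    and expfam: "canonical_expfam J \<nu> K b"
    and M: "prob_space M"
    and A1: "filtration (space M) F" "\<And>i. subalgebra M (F i)"
      "\<And>i. i \<ge> 1 \<Longrightarrow> X i \<in> F (i - 1) \<rightarrow>\<^sub>M restrict_space borel S"
      "\<And>i. i \<ge> 1 \<Longrightarrow> Y i \<in> F i \<rightarrow>\<^sub>M borel"
    and A2: "G ` I \<subseteq> deriv b ` J"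
      "\<And>i. i \<ge> 1 \<Longrightarrow> is_cond_distr M (F (i - 1)) (Y i)
         (\<lambda>\<omega>. expfam_measure \<nu> K b (canonical_param J b G (f (X i \<omega>) \<bullet> \<theta>bar)))"
    and start: "n_st \<ge> 1"
      "\<And>\<omega> \<theta>. \<omega> \<in> space M \<Longrightarrow> \<theta> \<in> \<Theta> \<Longrightarrow>
         pos_definite (info_matrix (glm_regressor J b G f \<theta>)
           (empirical_design (\<lambda>i. X i \<omega>) n_st))"
    and est: "adaptive_estimators S \<Theta> n_st est"
    and wynn: "\<And>n \<omega>. n \<ge> n_st \<Longrightarrow> \<omega> \<in> space M \<Longrightarrow>
      is_arg_max
        (\<lambda>x. let \<theta> = est n (history X Y n \<omega>); g = glm_regressor J b G f \<theta>
             in g x \<bullet> (matrix_inv (info_matrix g (empirical_design (\<lambda>i. X i \<omega>) n)) *v g x))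
        (\<lambda>x. x \<in> S) (X (n + 1) \<omega>)"
    and mle: "adaptive_estimators S \<Theta> n_st est_mle"
      "\<And>n \<omega>. n \<ge> n_st \<Longrightarrow> \<omega> \<in> space M \<Longrightarrow> (\<And>i. i \<in> {1..n} \<Longrightarrow> K (Y i \<omega>) > 0) \<Longrightarrow>
         is_arg_max (glm_log_likelihood J K b G f n (history X Y n \<omega>))
           (\<lambda>\<theta>. \<theta> \<in> \<Theta>) (est_mle n (history X Y n \<omega>))"
  shows "AE \<omega> in M. (\<lambda>n. est_mle n (history X Y n \<omega>)) \<longlonglongrightarrow> \<theta>bar"
proof -
  interpret prob_space M by fact
  define \<tau> where "\<tau> = canonical_param J b G"
  define h where "h \<theta> x = \<tau> (f x \<bullet> \<theta>) - \<tau> (f x \<bullet> \<theta>bar)" for \<theta> x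
  define e where "e i \<omega> = Y i \<omega> - G (f (X i \<omega>) \<bullet> \<theta>bar)" for i \<omega>
  \<comment> \<open>The normalized noise term of the log-likelihood ratio of \<open>\<theta>\<close> and \<open>\<theta>bar\<close>.\<close>
  define Q where "Q \<omega> n \<theta> = (\<Sum>i=1..n. h \<theta> (X i \<omega>) * e i \<omega>) / real n" for \<omega> n \<theta>

  have spF: "space (F i) = space M" for i
    by (rule filtration.space_F[OF A1(1)])
  have XS: "X i \<omega> \<in> S" if "i \<ge> 1" "\<omega> \<in> space M" for i \<omega>
    using measurable_space[OF A1(3)[OF that(1)], of \<omega>] that by (simp add: spF space_restrict_space)
  have history: "history X Y n \<omega> \<in> {1..n} \<rightarrow>\<^sub>E S \<times> UNIV" if "\<omega> \<in> space M" for n \<omega>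
    using XS[OF _ that] by (auto simp: history_def)

  have cpt: "compact ((\<lambda>(x, \<theta>). f x \<bullet> \<theta>) ` (S \<times> \<Theta>))" (is "compact ?U")
    by (intro compact_continuous_image compact_Times S \<Theta>)
      (auto simp: split_beta intro!: continuous_intros continuous_on_compose2[OF f(1)])
  have ne: "?U \<noteq> {}"
    using S(2) \<Theta>(2) by auto
  obtain lo where lo: "lo \<in> ?U" "\<And>u. u \<in> ?U \<Longrightarrow> lo \<le> u"
    using compact_attains_inf[OF cpt ne] by blast
  obtain hi where hi: "hi \<in> ?U" "\<And>u. u \<in> ?U \<Longrightarrow> u \<le> hi"
    using compact_attains_sup[OF cpt ne] by blast
  have U: "f x \<bullet> \<theta> \<in> {lo..hi}" if "x \<in> S" "\<theta> \<in> \<Theta>" for x \<theta>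
    using lo(2)[of "f x \<bullet> \<theta>"] hi(2)[of "f x \<bullet> \<theta>"] that by force
  have "lo \<in> I" "hi \<in> I"
    using lo(1) hi(1) I(3) by auto
  then have UI: "{lo..hi} \<subseteq> I"
    using I(2) unfolding is_interval_1 by (meson atLeastAtMost_iff subsetI)
  obtain c1 c2 L \<gamma> C where c1: "c1 > 0" and \<gamma>: "\<gamma> > 0"
    and w: "\<And>u. u \<in> {lo..hi} \<Longrightarrow> c1 \<le> glm_weight J b G u \<and> glm_weight J b G u \<le> c2"
    and lip: "\<And>u v. u \<in> {lo..hi} \<Longrightarrow> v \<in> {lo..hi} \<Longrightarrow> \<bar>\<tau> u - \<tau> v\<bar> \<le> L * \<bar>u - v\<bar>"
    and div: "\<And>u v. u \<in> {lo..hi} \<Longrightarrow> v \<in> {lo..hi} \<Longrightarrow>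
        \<gamma> * (u - v)\<^sup>2 \<le> b (\<tau> u) - b (\<tau> v) - G v * (\<tau> u - \<tau> v)"
    and C: "\<And>u. u \<in> {lo..hi} \<Longrightarrow> deriv (deriv b) (\<tau> u) + (G u)\<^sup>2 \<le> C"
    by (rule link_constants[OF expfam G(1) _ A2(1) UI, folded \<tau>_def], erule G(2)) (rule that; blast)
  have \<tau>J: "\<tau> u \<in> J" "deriv b (\<tau> u) = G u" if "u \<in> {lo..hi}" for u
    using canonical_param_inverse[OF A2(1), of u] UI that by (auto simp: \<tau>_def)
  have \<tau>_cont: "continuous_on {lo..hi} \<tau>"
    unfolding \<tau>_def
    by (rule DERIV_continuous_on, rule has_field_derivative_at_within,
        rule canonical_param_has_derivative[OF expfam G(1) A2(1)]) (use UI in auto)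
  have bf: "bounded (f ` S)"
    by (intro compact_imp_bounded compact_continuous_image f S)
  then obtain R where R: "\<And>x. x \<in> S \<Longrightarrow> norm (f x) \<le> R"
    by (auto simp: bounded_iff)
  have R0: "R \<ge> 0"
    using S(2) R norm_ge_zero order_trans by blast
  have h_lip: "\<bar>h \<theta> x - h \<theta>' x\<bar> \<le> \<bar>L\<bar> * R * dist \<theta> \<theta>'" if "x \<in> S" "\<theta> \<in> \<Theta>" "\<theta>' \<in> \<Theta>" for x \<theta> \<theta>'
  proof -
    have "\<bar>h \<theta> x - h \<theta>' x\<bar> \<le> L * \<bar>f x \<bullet> \<theta> - f x \<bullet> \<theta>'\<bar>"
      using lip[OF U U] that by (simp add: h_def)
    also have "\<dots> \<le> \<bar>L\<bar> * \<bar>f x \<bullet> (\<theta> - \<theta>')\<bar>"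
      by (simp add: inner_diff_right mult_right_mono)
    also have "\<dots> \<le> \<bar>L\<bar> * (R * dist \<theta> \<theta>')"
    proof (rule mult_left_mono)
      have "\<bar>f x \<bullet> (\<theta> - \<theta>')\<bar> \<le> norm (f x) * norm (\<theta> - \<theta>')"
        by (rule Cauchy_Schwarz_ineq2)
      also have "\<dots> \<le> R * norm (\<theta> - \<theta>')"
        using R[OF that(1)] by (rule mult_right_mono) simp
      finally show "\<bar>f x \<bullet> (\<theta> - \<theta>')\<bar> \<le> R * dist \<theta> \<theta>'"
        by (simp add: dist_norm)
    qed simp
    finally show ?thesis by (simp add: mult.assoc)
  qed

  have Ubar: "f (X i \<omega>) \<bullet> \<theta>bar \<in> {lo..hi}" if "i \<ge> 1" "\<omega> \<in> space M" for i \<omega>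
    using U XS \<Theta>(2) that by blast
  define \<kappa> where "\<kappa> i \<omega> = expfam_measure \<nu> K b (\<tau> (f (X i \<omega>) \<bullet> \<theta>bar))" for i \<omega>
  have \<kappa>: "is_cond_distr M (F (i - 1)) (Y i) (\<kappa> i)" if "i \<ge> 1" for i
    using A2(2)[OF that] by (simp add: \<kappa>_def[abs_def] \<tau>_def)
  have \<kappa>_mean: "(\<integral>y. y \<partial>\<kappa> i \<omega>) = G (f (X i \<omega>) \<bullet> \<theta>bar)"
    and \<kappa>_int: "integrable (\<kappa> i \<omega>) (\<lambda>y. y\<^sup>2)" and \<kappa>_C: "(\<integral>y. y\<^sup>2 \<partial>\<kappa> i \<omega>) \<le> C"
    if "i \<ge> 1" "\<omega> \<in> space M" for i \<omega>
    using \<tau>J[OF Ubar[OF that]] C[OF Ubar[OF that]] expfam_moments[OF expfam \<tau>J(1)[OF Ubar[OF that]]]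
    by (simp_all add: \<kappa>_def)
  have G_le: "\<bar>G (f (X i \<omega>) \<bullet> \<theta>bar)\<bar> \<le> 1 + C" if "i \<ge> 1" "\<omega> \<in> space M" for i \<omega>
    using is_cond_distr_mean_bound[OF M A1(2) measurable_from_subalg[OF A1(2) A1(4)[OF that(1)]] \<kappa>[OF that(1)], of "\<lambda>y. y" C \<omega>]
      \<kappa>_int \<kappa>_C \<kappa>_mean that by simp

  \<comment> \<open>Almost sure convergence for a fixed parameter; the exceptional set depends on it.\<close>
  have noise: "AE \<omega> in M. (\<lambda>n. Q \<omega> n \<theta>) \<longlonglongrightarrow> 0" if \<theta>: "\<theta> \<in> \<Theta>" for \<theta>
  proof -
    have h_meas: "(\<lambda>\<omega>. h \<theta> (X i \<omega>)) \<in> borel_measurable (F (i - 1))" if "i \<ge> 1" for i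
    proof -
      have "continuous_on S (h \<theta>)"
        unfolding h_def[abs_def]
        by (intro continuous_intros continuous_on_compose2[OF \<tau>_cont] f image_subsetI U \<theta> \<Theta>)
      from measurable_compose[OF A1(3)[OF that] borel_measurable_continuous_on_restrict[OF this]]
      show ?thesis .
    qed
    have "AE \<omega> in M. (\<lambda>n. (\<Sum>i=1..n. h \<theta> (X i \<omega>) * (Y i \<omega> - (\<integral>y. y \<partial>\<kappa> i \<omega>))) / real n) \<longlonglongrightarrow> 0"
    proof (rule conditionally_centered_averages_tendsto_0[OF M A1(1,2,4) \<kappa>])
      show "\<bar>h \<theta> (X i \<omega>)\<bar> \<le> \<bar>L\<bar> * R * dist \<theta> \<theta>bar" if "i \<ge> 1" "\<omega> \<in> space M" for i \<omega>
        using h_lip[OF XS[OF that] \<theta> \<Theta>(2)] by (simp add: h_def[of \<theta>bar])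
    qed (use h_meas \<kappa>_int \<kappa>_C in auto)
    with AE_space show ?thesis
    proof eventually_elim
      case (elim \<omega>)
      have "(\<Sum>i=1..n. h \<theta> (X i \<omega>) * (Y i \<omega> - (\<integral>y. y \<partial>\<kappa> i \<omega>))) = (\<Sum>i=1..n. h \<theta> (X i \<omega>) * e i \<omega>)" for n
        by (intro sum.cong refl) (use \<kappa>_mean[OF _ elim(1)] in \<open>simp add: e_def\<close>)
      with elim(2) show ?case
        by (simp only: Q_def)
    qed
  qed
  \<comment> \<open>The strong law for \<open>\<bar>Y\<^sub>i\<bar>\<close> keeps the averages of the absolute noise bounded, which makes \<open>Q \<omega> n\<close> Lipschitz with a constant independent of \<open>n\<close>.\<close>
  have abs: "AE \<omega> in M. (\<lambda>n. (\<Sum>i=1..n. 1 * (\<bar>Y i \<omega>\<bar> - (\<integral>y. \<bar>y\<bar> \<partial>\<kappa> i \<omega>))) / real n) \<longlonglongrightarrow> 0"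
    by (rule conditionally_centered_averages_tendsto_0[OF M A1(1,2,4) \<kappa>, where C = C and B = 1])
      (use \<kappa>_int \<kappa>_C in auto)
  have abs_mean: "\<bar>\<integral>y. \<bar>y\<bar> \<partial>\<kappa> i \<omega>\<bar> \<le> 1 + C" if "i \<ge> 1" "\<omega> \<in> space M" for i \<omega>
    using is_cond_distr_mean_bound[OF M A1(2) measurable_from_subalg[OF A1(2) A1(4)[OF that(1)]] \<kappa>[OF that(1)], of "\<lambda>y. \<bar>y\<bar>" C \<omega>]
      \<kappa>_int \<kappa>_C that by simp
  have K_pos: "AE \<omega> in M. \<forall>i\<in>{1..}. K (Y i \<omega>) > 0"
  proof (subst AE_ball_countable, simp, intro ballI)
    fix i :: nat assume "i \<in> {1..}"
    then have i: "i \<ge> 1" by simp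
    have K[measurable]: "K \<in> borel_measurable borel" and K0: "K y \<ge> 0" for y
      using expfam by (auto simp: canonical_expfam_def)
    have "AE \<omega> in M. Y i \<omega> \<notin> {y. K y = 0}"
    proof (rule is_cond_distr_AE_not_in_null_set[OF M A1(2) _ \<kappa>[OF i]])
      show "Y i \<in> borel_measurable M"
        by (rule measurable_from_subalg[OF A1(2) A1(4)[OF i]])
      show "measure (\<kappa> i \<omega>) {y. K y = 0} = 0" if "\<omega> \<in> space M" for \<omega>
        unfolding \<kappa>_def by (rule measure_expfam_weight_zero[OF expfam \<tau>J(1)[OF Ubar[OF i that]]])
    qed measurable
    then show "AE \<omega> in M. K (Y i \<omega>) > 0"
      by eventually_elim (use K0 in \<open>auto simp: order_less_le\<close>)
  qed

  \<comment> \<open>Countability of \<open>D\<close> yields one exceptional set for all its parameters.\<close>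
  obtain D where D: "countable D" "D \<subseteq> \<Theta>" "\<Theta> \<subseteq> closure D"
    using separable[of \<Theta>] by blast
  have noise_D: "AE \<omega> in M. \<forall>\<theta>\<in>D. (\<lambda>n. Q \<omega> n \<theta>) \<longlonglongrightarrow> 0"
    using noise D(2) by (subst AE_ball_countable[OF D(1)]) auto
  from noise_D abs K_pos AE_space show ?thesis
  proof eventually_elim
    case (elim \<omega>)
    note \<omega> = elim(4)
    define t where "t n = est_mle n (history X Y n \<omega>)" for n
    have argmax: "is_arg_max (glm_log_likelihood J K b G f n (history X Y n \<omega>)) (\<lambda>\<theta>. \<theta> \<in> \<Theta>) (t n)"
      if "n \<ge> n_st" for n
      unfolding t_def using mle(2)[OF that \<omega>] elim(3) by auto
    have t\<Theta>: "t n \<in> \<Theta>" if "n \<ge> n_st" for n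
      using argmax[OF that] by (simp add: is_arg_max_def)

    define wt where "wt n x = glm_weight J b G (f x \<bullet> est n (history X Y n \<omega>))" for n x
    have est\<Theta>: "est n (history X Y n \<omega>) \<in> \<Theta>" if "n \<ge> n_st" for n
    proof (rule funcset_mem[OF _ history[OF \<omega>]])
      show "est n \<in> ({1..n} \<rightarrow>\<^sub>E S \<times> UNIV) \<rightarrow> \<Theta>"
        using est that unfolding adaptive_estimators_def by blast
    qed
    have reg: "glm_regressor J b G f (est n (history X Y n \<omega>)) = (\<lambda>x. wt n x *\<^sub>R f x)" for n
      by (simp add: glm_regressor_def[abs_def] wt_def)
    have "\<exists>\<alpha>>0. \<forall>n\<ge>n_st. \<forall>v. \<alpha> * real n * (norm v)\<^sup>2 \<le> (\<Sum>i=1..n. (f (X i \<omega>) \<bullet> v)\<^sup>2)"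
    proof (rule wynn_information_growth[where w = wt, OF _ bf c1])
      show "X i \<omega> \<in> S" if "i \<ge> 1" for i
        using XS[OF that \<omega>] .
      show "c1 \<le> wt n x \<and> wt n x \<le> c2" if "n \<ge> n_st" "x \<in> S" for n x
        unfolding wt_def by (rule w[OF U[OF that(2) est\<Theta>[OF that(1)]]])
      show "pos_definite (info_matrix (\<lambda>x. wt n_st x *\<^sub>R f x) (empirical_design (\<lambda>i. X i \<omega>) n_st))"
        using start(2)[OF \<omega> est\<Theta>[of n_st]] by (simp add: reg)
      show "wt n s *\<^sub>R f s \<bullet> (matrix_inv (info_matrix (\<lambda>s. wt n s *\<^sub>R f s) (empirical_design (\<lambda>i. X i \<omega>) n)) *v wt n s *\<^sub>R f s)
          \<le> wt n (X (n + 1) \<omega>) *\<^sub>R f (X (n + 1) \<omega>) \<bullet>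
            (matrix_inv (info_matrix (\<lambda>s. wt n s *\<^sub>R f s) (empirical_design (\<lambda>i. X i \<omega>) n)) *v
              wt n (X (n + 1) \<omega>) *\<^sub>R f (X (n + 1) \<omega>))" if "n \<ge> n_st" "s \<in> S" for n s
        using wynn[OF that(1) \<omega>] that(2) by (auto simp: is_arg_max_def reg Let_def not_less)
    qed (rule start(1))
    then obtain \<alpha> where \<alpha>: "\<alpha> > 0"
      and growth: "\<And>n v. n \<ge> n_st \<Longrightarrow> \<alpha> * real n * (norm v)\<^sup>2 \<le> (\<Sum>i=1..n. (f (X i \<omega>) \<bullet> v)\<^sup>2)"
      by blast

    \<comment> \<open>The maximum likelihood estimate does at least as well as the true parameter; the gain by noise therefore covers the loss by divergence, which is at least \<open>\<gamma> \<alpha> n\<close> times the squared distance to the true parameter.\<close>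
    have mle_bound: "(norm (t n - \<theta>bar))\<^sup>2 \<le> Q \<omega> n (t n) / (\<gamma> * \<alpha>)" if n: "n \<ge> n_st" for n
    proof -
      have n0: "real n > 0" using n start(1) by simp
      have "glm_log_likelihood J K b G f n (history X Y n \<omega>) \<theta>bar
        \<le> glm_log_likelihood J K b G f n (history X Y n \<omega>) (t n)"
        using argmax[OF n] \<Theta>(2) by (auto simp: is_arg_max_def not_less)
      then have "0 \<le> (\<Sum>i=1..n. h (t n) (X i \<omega>) * Y i \<omega> - (b (\<tau> (f (X i \<omega>) \<bullet> t n)) - b (\<tau> (f (X i \<omega>) \<bullet> \<theta>bar))))"
        by (simp add: glm_log_likelihood_def history_def Let_def \<tau>_def[symmetric] h_def
            sum.distrib sum_subtractf algebra_simps)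
      also have "\<dots> \<le> (\<Sum>i=1..n. h (t n) (X i \<omega>) * e i \<omega> - \<gamma> * (f (X i \<omega>) \<bullet> (t n - \<theta>bar))\<^sup>2)"
      proof (rule sum_mono)
        fix i assume "i \<in> {1..n}"
        then have "X i \<omega> \<in> S" using XS \<omega> by auto
        from div[OF U[OF this t\<Theta>[OF n]] U[OF this \<Theta>(2)]]
        show "h (t n) (X i \<omega>) * Y i \<omega> - (b (\<tau> (f (X i \<omega>) \<bullet> t n)) - b (\<tau> (f (X i \<omega>) \<bullet> \<theta>bar)))
            \<le> h (t n) (X i \<omega>) * e i \<omega> - \<gamma> * (f (X i \<omega>) \<bullet> (t n - \<theta>bar))\<^sup>2"
          by (simp add: h_def e_def inner_diff_right algebra_simps)
      qed
      also have "\<dots> = real n * Q \<omega> n (t n) - \<gamma> * (\<Sum>i=1..n. (f (X i \<omega>) \<bullet> (t n - \<theta>bar))\<^sup>2)"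
        unfolding sum_subtractf sum_distrib_left[symmetric] using n0 by (simp add: Q_def)
      also have "\<dots> \<le> real n * Q \<omega> n (t n) - \<gamma> * (\<alpha> * real n * (norm (t n - \<theta>bar))\<^sup>2)"
        using mult_left_mono[OF growth[OF n, of "t n - \<theta>bar"], of \<gamma>] \<gamma> by simp
      also have "\<dots> = real n * (Q \<omega> n (t n) - \<gamma> * \<alpha> * (norm (t n - \<theta>bar))\<^sup>2)"
        by (simp add: algebra_simps)
      finally show ?thesis
        using n0 \<alpha> \<gamma> by (simp add: zero_le_mult_iff field_simps)
    qed

    have lip_ev: "eventually (\<lambda>n. \<forall>\<theta>\<in>\<Theta>. \<forall>\<theta>'\<in>\<Theta>. \<bar>Q \<omega> n \<theta> - Q \<omega> n \<theta>'\<bar> \<le> (\<bar>L\<bar> * R * (2 * C + 3)) * dist \<theta> \<theta>') sequentially"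
      using tendstoD[OF elim(2), of 1, simplified] eventually_ge_at_top[of 1]
    proof eventually_elim
      case (elim n)
      then have n: "real n > 0" by simp
      have "(\<Sum>i=1..n. \<bar>Y i \<omega>\<bar> - (\<integral>y. \<bar>y\<bar> \<partial>\<kappa> i \<omega>)) \<le> real n"
        using elim n by (simp add: dist_real_def abs_le_iff field_simps)
      moreover have "(\<Sum>i=1..n. \<integral>y. \<bar>y\<bar> \<partial>\<kappa> i \<omega>) \<le> (\<Sum>i=1..n. 1 + C)"
        using abs_mean \<omega> by (intro sum_mono) (auto simp: abs_le_iff)
      moreover have "(\<Sum>i=1..n. \<bar>e i \<omega>\<bar>) \<le> (\<Sum>i=1..n. \<bar>Y i \<omega>\<bar> + (1 + C))"
      proof (rule sum_mono)
        fix i assume "i \<in> {1..n}"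
        then show "\<bar>e i \<omega>\<bar> \<le> \<bar>Y i \<omega>\<bar> + (1 + C)"
          using G_le[of i \<omega>] \<omega> unfolding e_def by force
      qed
      ultimately have e_sum: "(\<Sum>i=1..n. \<bar>e i \<omega>\<bar>) \<le> real n * (2 * C + 3)"
        by (simp add: sum_subtractf sum.distrib algebra_simps)
      show ?case
      proof (intro ballI)
        fix \<theta> \<theta>' assume \<theta>: "\<theta> \<in> \<Theta>" "\<theta>' \<in> \<Theta>"
        have "\<bar>\<Sum>i=1..n. (h \<theta> (X i \<omega>) - h \<theta>' (X i \<omega>)) * e i \<omega>\<bar> \<le> (\<Sum>i=1..n. (\<bar>L\<bar> * R * dist \<theta> \<theta>') * \<bar>e i \<omega>\<bar>)"
          using h_lip XS \<omega> \<theta> by (intro order_trans[OF sum_abs] sum_mono) (auto simp: abs_mult intro!: mult_right_mono)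
        also have "\<dots> \<le> (\<bar>L\<bar> * R * dist \<theta> \<theta>') * (real n * (2 * C + 3))"
          unfolding sum_distrib_left[symmetric] using e_sum R0 by (intro mult_left_mono) auto
        finally have "\<bar>\<Sum>i=1..n. (h \<theta> (X i \<omega>) - h \<theta>' (X i \<omega>)) * e i \<omega>\<bar> / real n
            \<le> (\<bar>L\<bar> * R * (2 * C + 3)) * dist \<theta> \<theta>'"
          using n by (simp add: field_simps)
        moreover have "Q \<omega> n \<theta> - Q \<omega> n \<theta>' = (\<Sum>i=1..n. (h \<theta> (X i \<omega>) - h \<theta>' (X i \<omega>)) * e i \<omega>) / real n"
          by (simp add: Q_def diff_divide_distrib[symmetric] sum_subtractf left_diff_distrib)
        ultimately show "\<bar>Q \<omega> n \<theta> - Q \<omega> n \<theta>'\<bar> \<le> (\<bar>L\<bar> * R * (2 * C + 3)) * dist \<theta> \<theta>'"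
          using n by simp
      qed
    qed
    have "(\<lambda>n. Q \<omega> n (t n)) \<longlonglongrightarrow> 0"
    proof (rule equi_Lipschitz_tendsto_0_along[OF \<Theta>(1) D(2,3) _ lip_ev])
      show "(\<lambda>n. Q \<omega> n d) \<longlonglongrightarrow> 0" if "d \<in> D" for d
        using elim(1) that by blast
      show "eventually (\<lambda>n. t n \<in> \<Theta>) sequentially"
        unfolding eventually_sequentially using t\<Theta> by blast
    qed
    then have "(\<lambda>n. Q \<omega> n (t n) / (\<gamma> * \<alpha>)) \<longlonglongrightarrow> 0"
      using tendsto_divide[of "\<lambda>n. Q \<omega> n (t n)" 0 sequentially "\<lambda>n. \<gamma> * \<alpha>" "\<gamma> * \<alpha>"] \<alpha> \<gamma> by simp
    moreover have "eventually (\<lambda>n. norm ((norm (t n - \<theta>bar))\<^sup>2) \<le> Q \<omega> n (t n) / (\<gamma> * \<alpha>)) sequentially"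
      unfolding eventually_sequentially using mle_bound by (intro exI[of _ n_st]) simp
    ultimately have "(\<lambda>n. (norm (t n - \<theta>bar))\<^sup>2) \<longlonglongrightarrow> 0"
      by (rule Lim_null_comparison[rotated])
    from tendsto_real_sqrt[OF this] have "(\<lambda>n. norm (t n - \<theta>bar)) \<longlonglongrightarrow> 0"
      by simp
    then show ?case
      unfolding t_def by (subst LIM_zero_iff[symmetric]) (rule tendsto_norm_zero_cancel)
  qed
qed

end
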